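(* Let $X$ be a metrizable space and let $Y$ be a perfectly normal space. Let $D(X)$ be either $C(X)$ or $C^*(X)$, and, independently, let $D(Y)$ be either $C(Y)$ or $C^*(Y)$. Suppose that $T: D_p(X)\to D_p(Y)$ is a uniformly continuous inversely bounded surjection. Let $\mathcal P$ be any topological property of normal spaces satisfying the following conditions: (a) if $Z\in\mathcal P$ and $F\subset Z$ is closed, then $F\in\mathcal P$; (b) $\mathcal P$ is closed under finite products; (c) if $Z$ is a countable union of closed subsets each having the property $\mathcal P$, then $Z\in\mathcal P$; (d) if $f: Z\to W$ is a closed map with finite fibers, where $W$ is a metrizable space with $W\in\mathcal P$, then $Z\in\mathcal P$. If $X\in\mathcal P$, then $Y\in\mathcal P$.
   Context: All spaces are Tychonoff; maps between topological spaces in (d) are continuous. "$Z\in\mathcal P$" means that the space $Z$ has the property $\mathcal P$; $\mathcal P$ is a property of normal spaces. For a Tychonoff space $X$, $C(X)$ is the linear space of all continuous real-valued functions on $X$, and $C^*(X)\subset C(X)$ is the subspace of bounded functions. $D_p(X)$ denotes $D(X)$ endowed with the topology of pointwise convergence. The choices for $D(X)$ and $D(Y)$ are independent, so all four combinations are covered. A map $T: D_p(X)\to D_p(Y)$ (not necessarily linear) is uniformly continuous if for every neighborhood $U$ of the zero function in $D_p(Y)$ there is a neighborhood $V$ of the zero function in $D_p(X)$ such that $f,g\in D_p(X)$ and $f-g\in V$ imply $T(f)-T(g)\in U$. $\|f\|$ denotes the supremum norm of a bounded function $f$. A sequence $\{g_n: n\in\mathbb N\}$ of bounded continuous functions is norm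 bounded if there is $M>0$ with $\|g_n\|\le M$ for all $n$. A map $T: D(X)\to D(Y)$ is inversely bounded if for every norm bounded sequence $\{g_n\}\subset C^*(Y)$ there is a norm bounded sequence $\{f_n\}\subset C^*(X)$ with $T(f_n)=g_n$ for each $n\in\mathbb N$. *)

theory Defs
  imports "HOL-Analysis.Analysis"
begin

text \<open>Every space is Tychonoff by convention, so normality and perfect normality include the
  Hausdorff axiom, which the library's \<^const>\<open>normal_space\<close> does not.\<close>

definition T4_space :: "'a topology \<Rightarrow> bool" where
  "T4_space X \<longleftrightarrow> normal_space X \<and> Hausdorff_space X"

definition perfectly_normal_space :: "'a topology \<Rightarrow> bool" where
  "perfectly_normal_space X \<longleftrightarrow> T4_space X \<and> (\<forall>F. closedin X F \<longrightarrow> gdelta_in X F)"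

text \<open>A function on a space is represented by its extensional representative (equal to
  \<^const>\<open>undefined\<close> off the carrier), so that equality of functions on the space is HOL equality and
  the function spaces lie inside the product space of \<^typ>\<open>real\<close> over the carrier.\<close>

definition C_fun :: "'a topology \<Rightarrow> ('a \<Rightarrow> real) set" where
  "C_fun X = {f \<in> extensional (topspace X). continuous_map X euclideanreal f}"

definition Cstar_fun :: "'a topology \<Rightarrow> ('a \<Rightarrow> real) set" where
  "Cstar_fun X = {f \<in> C_fun X. bounded (f ` topspace X)}"

definition pointwise_topology :: "'a topology \<Rightarrow> ('a \<Rightarrow> real) set \<Rightarrow> ('a \<Rightarrow> real) topology" where
  "pointwise_topology X D = subtopology (product_topology (\<lambda>x. euclideanreal) (topspace X)) D"

definition zero_fun :: "'a topology \<Rightarrow> 'a \<Rightarrow> real" where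
  "zero_fun X = (\<lambda>x\<in>topspace X. 0)"

definition diff_fun :: "'a topology \<Rightarrow> ('a \<Rightarrow> real) \<Rightarrow> ('a \<Rightarrow> real) \<Rightarrow> 'a \<Rightarrow> real" where
  "diff_fun X f g = (\<lambda>x\<in>topspace X. f x - g x)"

definition uniformly_continuous_Dp ::
  "'a topology \<Rightarrow> ('a \<Rightarrow> real) set \<Rightarrow> 'b topology \<Rightarrow> ('b \<Rightarrow> real) set \<Rightarrow>
    (('a \<Rightarrow> real) \<Rightarrow> 'b \<Rightarrow> real) \<Rightarrow> bool" where
  "uniformly_continuous_Dp X D Y E T \<longleftrightarrow>
    (\<forall>U. openin (pointwise_topology Y E) U \<and> zero_fun Y \<in> U \<longrightarrow>
      (\<exists>V. openin (pointwise_topology X D) V \<and> zero_fun X \<in> V \<and>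
        (\<forall>f\<in>D. \<forall>g\<in>D. diff_fun X f g \<in> V \<longrightarrow> diff_fun Y (T f) (T g) \<in> U)))"

text \<open>The case distinction is needed because the supremum of the empty set of reals is
  unspecified.\<close>

definition sup_norm :: "'a topology \<Rightarrow> ('a \<Rightarrow> real) \<Rightarrow> real" where
  "sup_norm X f = (if topspace X = {} then 0 else (SUP x\<in>topspace X. \<bar>f x\<bar>))"

definition norm_bounded_seq :: "'a topology \<Rightarrow> (nat \<Rightarrow> 'a \<Rightarrow> real) \<Rightarrow> bool" where
  "norm_bounded_seq X g \<longleftrightarrow>
    (\<forall>n. g n \<in> Cstar_fun X) \<and> (\<exists>M>0. \<forall>n. sup_norm X (g n) \<le> M)"

definition inversely_bounded ::
  "'a topology \<Rightarrow> 'b topology \<Rightarrow> (('a \<Rightarrow> real) \<Rightarrow> 'b \<Rightarrow> real) \<Rightarrow> bool" where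
  "inversely_bounded X Y T \<longleftrightarrow>
    (\<forall>g. norm_bounded_seq Y g \<longrightarrow> (\<exists>f. norm_bounded_seq X f \<and> (\<forall>n. T (f n) = g n)))"

text \<open>Topological properties are modelled as homeomorphism-invariant predicates on the topologies
  over one type \<^typ>\<open>'u\<close>, the universe of points; the predicates below require the closure
  conditions only for spaces over \<^typ>\<open>'u\<close>. Spaces over different types are covered by copying them
  into a common type, for instance a sum type. Since a product of spaces over \<^typ>\<open>'u\<close>
  lives over another type, closure under products is stated for the homeomorphic copies over
  \<^typ>\<open>'u\<close>.

  The spaces in question are the normal ones: a predicate implies \<^const>\<open>T4_space\<close>, and a
  closure condition concludes only about spaces known to be normal. For countable closed unions this
  restriction matters, as such a union of normal subspaces of a Tychonoff space need not be normal
  (the Niemytzki plane); for closed maps with finite fibers into metrizable spaces it is automatic.\<close>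

definition property_of_normal_spaces :: "('u topology \<Rightarrow> bool) \<Rightarrow> bool" where
  "property_of_normal_spaces P \<longleftrightarrow>
    (\<forall>Z. P Z \<longrightarrow> T4_space Z) \<and> (\<forall>Z W. Z homeomorphic_space W \<and> P Z \<longrightarrow> P W)"

definition closed_hereditary :: "('u topology \<Rightarrow> bool) \<Rightarrow> bool" where
  "closed_hereditary P \<longleftrightarrow> (\<forall>Z F. P Z \<and> closedin Z F \<longrightarrow> P (subtopology Z F))"

definition finitely_productive :: "('u topology \<Rightarrow> bool) \<Rightarrow> bool" where
  "finitely_productive P \<longleftrightarrow>
    (\<forall>(I :: nat set) K Z. finite I \<and> I \<noteq> {} \<and> (\<forall>i\<in>I. P (K i)) \<and>
      T4_space Z \<and> Z homeomorphic_space product_topology K I \<longrightarrow> P Z)"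

definition closed_under_countable_closed_unions :: "('u topology \<Rightarrow> bool) \<Rightarrow> bool" where
  "closed_under_countable_closed_unions P \<longleftrightarrow>
    (\<forall>Z \<K>. T4_space Z \<and> countable \<K> \<and> (\<forall>F\<in>\<K>. closedin Z F \<and> P (subtopology Z F)) \<and>
      \<Union>\<K> = topspace Z \<longrightarrow> P Z)"

definition pulled_back_by_closed_finite_fiber_maps :: "('u topology \<Rightarrow> bool) \<Rightarrow> bool" where
  "pulled_back_by_closed_finite_fiber_maps P \<longleftrightarrow>
    (\<forall>Z W f. T4_space Z \<and> metrizable_space W \<and> P W \<and>
      continuous_map Z W f \<and> closed_map Z W f \<and>
      (\<forall>w\<in>topspace W. finite {z \<in> topspace Z. f z = w}) \<longrightarrow> P Z)"

end

theory Submission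
  imports Defs
begin

text \<open>Say that a finite set \<open>K \<subseteq> X\<close> controls a point \<open>y\<close> of \<open>Y\<close> with bound \<open>p\<close> if \<open>\<bar>f - g\<bar> < 1\<close> on \<open>K\<close>
  implies \<open>\<bar>T f y - T g y\<bar> \<le> p\<close> (Gul'ko's supports). Uniform continuity provides such a set for
  every \<open>y\<close>, and the points controlled with bound \<open>p\<close> by at most \<open>q\<close> points form a closed set
  \<open>level p q\<close>. As the intersection of two controlling sets controls with the sum of the bounds,
  a point of \<open>level p q - level (2p) (q - 1)\<close> has a unique controlling set of size at most \<open>q\<close>
  with bound \<open>p\<close>, and this set depends continuously on the point. These differences cover \<open>Y\<close>
  and, by perfect normality, are countable unions of closed sets. Stone's theorem for \<open>X\<close> splits
  them further into countably many closed pieces on which the controlling sets can be enumerated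
  continuously, giving maps from the pieces to \<open>X\<^sup>q\<close>. Inverse boundedness and the pigeonhole
  principle make these maps closed with finite fibres: a norm bounded sequence of functions on \<open>Y\<close>
  lifts to one on \<open>X\<close>, two terms of which are within distance 1 on a given finite set.

  If \<open>X\<close> is finite, the powers of \<open>X\<close> need not have copies over the universe \<open>'u\<close>, but then
  \<open>Y\<close> is countable.\<close>

section \<open>Function spaces\<close>

lemma diff_fun_mem:
  assumes "D = C_fun X \<or> D = Cstar_fun X" "f \<in> D" "g \<in> D"
  shows "diff_fun X f g \<in> D"
proof -
  have C: "diff_fun X f g \<in> C_fun X" if "f \<in> C_fun X" "g \<in> C_fun X" for f g
  proof -
    have "continuous_map X euclideanreal (\<lambda>x. f x - g x)"
      using that by (intro continuous_map_diff) (auto simp: C_fun_def)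
    then have "continuous_map X euclideanreal (diff_fun X f g)"
      unfolding diff_fun_def by (rule continuous_map_eq) auto
    then show ?thesis
      by (auto simp: C_fun_def diff_fun_def)
  qed
  have "diff_fun X f g \<in> Cstar_fun X" if f: "f \<in> Cstar_fun X" and g: "g \<in> Cstar_fun X" for f g
  proof -
    have "bounded ((\<lambda>x. f x - g x) ` topspace X)"
      using that by (intro bounded_minus_comp) (auto simp: Cstar_fun_def)
    moreover have "diff_fun X f g ` topspace X = (\<lambda>x. f x - g x) ` topspace X"
      by (auto simp: diff_fun_def)
    ultimately show ?thesis
      using C f g by (auto simp: Cstar_fun_def)
  qed
  then show ?thesis
    using assms C by auto
qed

text \<open>Between \<open>f\<close> and \<open>g\<close> at every point, so boundedness survives. A
  variable weight serves \<open>blend\<close>, a constant one the subdivision in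
  \<open>controls_exists\<close>.\<close>

lemma blend_mem:
  assumes D: "D = C_fun X \<or> D = Cstar_fun X" and f: "f \<in> D" and g: "g \<in> D"
    and \<phi>: "continuous_map X euclideanreal \<phi>" "\<And>x. x \<in> topspace X \<Longrightarrow> 0 \<le> \<phi> x \<and> \<phi> x \<le> 1"
  shows "(\<lambda>x\<in>topspace X. g x + \<phi> x * (f x - g x)) \<in> D" (is "?h \<in> D")
proof -
  have fg: "f \<in> C_fun X" "g \<in> C_fun X"
    using D f g by (auto simp: Cstar_fun_def)
  have "continuous_map X euclideanreal (\<lambda>x. g x + \<phi> x * (f x - g x))"
    using fg \<phi>(1) by (intro continuous_intros) (auto simp: C_fun_def)
  then have "continuous_map X euclideanreal ?h"
    by (rule continuous_map_eq) auto
  then have hC: "?h \<in> C_fun X"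
    by (auto simp: C_fun_def)
  show ?thesis
  proof (cases "D = C_fun X")
    case False
    then have "f \<in> Cstar_fun X" "g \<in> Cstar_fun X"
      using D f g by auto
    then obtain a b where ab: "\<And>x. x \<in> topspace X \<Longrightarrow> \<bar>f x\<bar> \<le> a" "\<And>x. x \<in> topspace X \<Longrightarrow> \<bar>g x\<bar> \<le> b"
      unfolding Cstar_fun_def bounded_iff by force
    have "\<bar>?h x\<bar> \<le> b + (a + b)" if x: "x \<in> topspace X" for x
    proof -
      have "\<bar>\<phi> x * (f x - g x)\<bar> \<le> 1 * \<bar>f x - g x\<bar>"
        unfolding abs_mult by (rule mult_right_mono) (use \<phi>(2)[OF x] in auto)
      then show ?thesis
        using ab[OF x] x by auto
    qed
    then have "bounded (?h ` topspace X)"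
      unfolding bounded_iff real_norm_def by blast
    then show ?thesis
      using hC False D by (auto simp: Cstar_fun_def)
  qed (use hC in auto)
qed

text \<open>The weight is a Urysohn function equal to 1 on \<open>F\<close> and 0 off
  \<open>G\<close>. The last conclusion preserves closeness to \<open>g\<close> where the transition
  takes place.\<close>

lemma blend:
  assumes D: "D = C_fun X \<or> D = Cstar_fun X" and f: "f \<in> D" and g: "g \<in> D"
    and X: "normal_space X" and F: "closedin X F" and G: "openin X G" "F \<subseteq> G"
  obtains h where "h \<in> D" "\<And>x. x \<in> F \<Longrightarrow> h x = f x"
    "\<And>x. x \<in> topspace X - G \<Longrightarrow> h x = g x"
    "\<And>x. x \<in> topspace X \<Longrightarrow> \<bar>h x - g x\<bar> \<le> \<bar>f x - g x\<bar>"
proof -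
  have "disjnt (topspace X - G) F"
    using G by (auto simp: disjnt_iff)
  then obtain \<phi> where \<phi>: "continuous_map X (top_of_set {0..1::real}) \<phi>"
      "\<phi> ` (topspace X - G) \<subseteq> {0}" "\<phi> ` F \<subseteq> {1}"
    using Urysohn_lemma[OF X _ F, of "topspace X - G" 0 1] G by auto
  have F': "F \<subseteq> topspace X"
    using F by (rule closedin_subset)
  have \<phi>': "continuous_map X euclideanreal \<phi>" "\<And>x. x \<in> topspace X \<Longrightarrow> 0 \<le> \<phi> x \<and> \<phi> x \<le> 1"
    using \<phi>(1) by (auto simp: continuous_map_in_subtopology)
  show ?thesis
  proof
    show "(\<lambda>x\<in>topspace X. g x + \<phi> x * (f x - g x)) \<in> D"
      by (rule blend_mem[OF D f g \<phi>'])
  next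
    fix x assume "x \<in> topspace X"
    have "\<bar>\<phi> x * (f x - g x)\<bar> \<le> 1 * \<bar>f x - g x\<bar>"
      unfolding abs_mult by (rule mult_right_mono) (use \<phi>'(2)[OF \<open>x \<in> _\<close>] in auto)
    then show "\<bar>(\<lambda>x\<in>topspace X. g x + \<phi> x * (f x - g x)) x - g x\<bar> \<le> \<bar>f x - g x\<bar>"
      using \<open>x \<in> _\<close> by simp
  qed (use \<phi>(2,3) F' in \<open>auto simp: image_subset_iff\<close>)
qed

lemma const_mem_Cstar_fun: "(\<lambda>y\<in>topspace Y. c) \<in> Cstar_fun Y"
proof -
  have "continuous_map Y euclideanreal (\<lambda>y\<in>topspace Y. c)"
    by (rule continuous_map_eq[of _ _ "\<lambda>y. c"]) auto
  moreover have "bounded ((\<lambda>y\<in>topspace Y. c) ` topspace Y)"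
    unfolding bounded_iff by (intro exI[of _ "\<bar>c\<bar>"]) auto
  ultimately show ?thesis
    by (auto simp: Cstar_fun_def C_fun_def)
qed

lemma zero_fun_mem: "zero_fun X \<in> Cstar_fun X"
  unfolding zero_fun_def by (rule const_mem_Cstar_fun)

lemma topspace_pointwise_topology:
  assumes "D = C_fun X \<or> D = Cstar_fun X"
  shows "topspace (pointwise_topology X D) = D"
  using assms
  by (auto simp: pointwise_topology_def Cstar_fun_def C_fun_def PiE_def)

lemma openin_pointwise_ball:
  assumes "D = C_fun X \<or> D = Cstar_fun X" "x \<in> topspace X"
  shows "openin (pointwise_topology X D) {f \<in> D. \<bar>f x\<bar> < e}"
proof -
  have "continuous_map (product_topology (\<lambda>x. euclideanreal) (topspace X)) euclideanreal (\<lambda>f. f x)"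
    using assms(2) by (rule continuous_map_product_projection)
  then have "continuous_map (pointwise_topology X D) euclideanreal (\<lambda>f. f x)"
    unfolding pointwise_topology_def by (rule continuous_map_from_subtopology)
  then have "openin (pointwise_topology X D) {f \<in> topspace (pointwise_topology X D). f x \<in> {-e<..<e}}"
    by (rule openin_continuous_map_preimage) auto
  also have "{f \<in> topspace (pointwise_topology X D). f x \<in> {-e<..<e}} = {f \<in> D. \<bar>f x\<bar> < e}"
    unfolding topspace_pointwise_topology[OF assms(1)] by auto
  finally show ?thesis .
qed

text \<open>A basic open set of the product constrains only finitely many coordinates, and there
  each factor contains a ball around 0; \<open>\<delta>\<close> is the least of the radii.\<close>

lemma pointwise_nhd_zero:
  assumes "openin (pointwise_topology X D) V" "zero_fun X \<in> V"
  obtains E \<delta> where "finite E" "E \<subseteq> topspace X" "\<delta> > 0"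
    "\<And>f. f \<in> D \<Longrightarrow> f \<in> extensional (topspace X) \<Longrightarrow> (\<And>x. x \<in> E \<Longrightarrow> \<bar>f x\<bar> < \<delta>) \<Longrightarrow> f \<in> V"
proof -
  obtain V' where V': "openin (product_topology (\<lambda>x. euclideanreal) (topspace X)) V'" "V = V' \<inter> D"
    using assms(1) by (auto simp: pointwise_topology_def openin_subtopology)
  then obtain U where U: "finite {i \<in> topspace X. U i \<noteq> (UNIV::real set)}"
      "\<And>i. i \<in> topspace X \<Longrightarrow> open (U i)" "zero_fun X \<in> Pi\<^sub>E (topspace X) U"
      "Pi\<^sub>E (topspace X) U \<subseteq> V'"
    using assms(2) by (auto simp: openin_product_topology_alt)
  define E where "E = {i \<in> topspace X. U i \<noteq> UNIV}"
  have "\<exists>d>0. ball 0 d \<subseteq> U i" if "i \<in> E" for i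
  proof -
    have "0 \<in> U i"
      using U(3) that by (auto simp: zero_fun_def E_def PiE_iff)
    then show ?thesis
      using U(2)[of i] that by (auto simp: open_contains_ball E_def)
  qed
  then obtain d where d: "\<And>i. i \<in> E \<Longrightarrow> d i > 0 \<and> ball 0 (d i) \<subseteq> U i"
    by metis
  define \<delta> where "\<delta> = Min (insert 1 (d ` E))"
  have fE: "finite E"
    using U(1) by (simp add: E_def)
  have \<delta>: "\<delta> > 0" "\<And>i. i \<in> E \<Longrightarrow> \<delta> \<le> d i"
    using fE d by (auto simp: \<delta>_def)
  show ?thesis
  proof
    show "finite E" "E \<subseteq> topspace X" "\<delta> > 0"
      using fE \<delta> by (auto simp: E_def)
  next
    fix f assume f: "f \<in> D" "f \<in> extensional (topspace X)" "\<And>x. x \<in> E \<Longrightarrow> \<bar>f x\<bar> < \<delta>"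
    have "f x \<in> U x" if "x \<in> topspace X" for x
    proof (cases "x \<in> E")
      case True
      then have "f x \<in> ball 0 (d x)"
        using f(3)[OF True] \<delta>(2)[OF True] by auto
      then show ?thesis
        using d[OF True] by auto
    qed (use that in \<open>auto simp: E_def\<close>)
    then have "f \<in> Pi\<^sub>E (topspace X) U"
      using f(2) by (auto simp: PiE_def)
    then show "f \<in> V"
      using U(4) V'(2) f(1) by auto
  qed
qed

section \<open>Tagged closed covers of metrizable spaces\<close>

text \<open>The sets \<open>A n\<close> come from M. E. Rudin's proof of Stone's theorem: \<open>t\<close> sends a point to
  the least centre, in a well-ordering of the space, within distance \<open>\<delta>\<close> of it, and
  \<open>A n\<close> consists of the points whose ball of radius \<open>1/(n + 1)\<close> lies in the \<open>\<delta>\<close>-ball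
  around that centre; points of \<open>A n\<close> with different centres are at least \<open>1/(n + 1)\<close> apart.\<close>
lemma (in Metric_space) tagged_closed_cover_scale:
  assumes \<delta>: "\<delta> > 0"
  obtains A :: "nat \<Rightarrow> 'a set" and t :: "'a \<Rightarrow> 'a" where
    "\<And>n. closedin mtopology (A n)" "\<And>m n. m \<le> n \<Longrightarrow> A m \<subseteq> A n" "(\<Union>n. A n) = M"
    "\<And>n x. x \<in> A n \<Longrightarrow> \<exists>G. openin mtopology G \<and> x \<in> G \<and> (\<forall>z\<in>G \<inter> A n. t z = t x)"
    "\<And>x. x \<in> M \<Longrightarrow> t x \<in> M \<and> d x (t x) < \<delta>"
proof -
  obtain r :: "'a rel" where r: "Well_order r" "Field r = UNIV"
    using well_ordering[where 'a = 'a] by blast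
  have wf: "wf (r - Id)"
    using r(1) by (auto simp: well_order_on_def)
  have tot: "x = y \<or> (x,y) \<in> r - Id \<or> (y,x) \<in> r - Id" for x y
    using r by (auto simp: well_order_on_def linear_order_on_def total_on_def)
  define N where "N x = {z \<in> M. d x z < \<delta>}" for x
  have "\<exists>z. z \<in> N x \<and> (\<forall>y. (y,z) \<in> r - Id \<longrightarrow> y \<notin> N x)" if "x \<in> M" for x
  proof -
    have "x \<in> N x"
      using that \<delta> by (auto simp: N_def)
    from wfE_min[OF wf this] show ?thesis
      by metis
  qed
  then obtain t where t: "\<And>x. x \<in> M \<Longrightarrow> t x \<in> N x"
      "\<And>x y. x \<in> M \<Longrightarrow> (y, t x) \<in> r - Id \<Longrightarrow> y \<notin> N x"
    by metis
  define A where "A n = {x \<in> M. \<forall>v\<in>M. d x v < 1 / real (Suc n) \<longrightarrow> d v (t x) < \<delta>}" for n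
  \<comment> \<open>The small ball around \<open>x\<close> lies in the \<open>\<delta>\<close>-ball
    around \<open>t x\<close>, so \<open>t x\<close> is a candidate for the least centre near
    \<open>y\<close> and cannot precede \<open>t y\<close>.\<close>
  have less: "(t x, t y) \<notin> r - Id" if "x \<in> A n" "y \<in> M" "d x y < 1 / real (Suc n)" for n x y
  proof
    assume "(t x, t y) \<in> r - Id"
    then have "t x \<notin> N y"
      using t(2) that by blast
    moreover have "t x \<in> M"
      using t(1) that by (auto simp: A_def N_def)
    ultimately show False
      using that by (auto simp: A_def N_def)
  qed
  have eq: "t x = t y" if "x \<in> A n" "y \<in> A n" "d x y < 1 / real (Suc n)" for n x y
  proof -
    have "x \<in> M" "y \<in> M" "d y x < 1 / real (Suc n)"
      using that by (auto simp: A_def commute)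
    with that show ?thesis
      using less[of x n y] less[of y n x] tot by blast
  qed
  show ?thesis
  proof
    \<comment> \<open>Points of \<open>A n\<close> near a limit \<open>w\<close> share one centre
      \<open>t x\<close>. It is admissible for \<open>w\<close>, and a smaller centre of
      \<open>w\<close> would be admissible for points of \<open>A n\<close> close to
      \<open>w\<close>; so \<open>t w = t x\<close>, and the ball condition passes to
      \<open>w\<close>.\<close>
    show "closedin mtopology (A n)" for n
      unfolding closedin_metric
    proof (intro conjI allI impI)
      show "A n \<subseteq> M"
        by (auto simp: A_def)
      fix w assume w: "w \<in> M - A n"
      show "\<exists>r>0. disjnt (A n) (mball w r)"
      proof (rule ccontr)
        assume no: "\<not> ?thesis"
        have near: "\<exists>x\<in>A n. d w x < r" if "r > 0" for r
        proof -
          have "\<not> disjnt (A n) (mball w r)"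
            using no that by blast
          then show ?thesis
            by (auto simp: disjnt_iff)
        qed
        define e where "e = 1 / real (Suc n)"
        have e: "e > 0"
          by (auto simp: e_def)
        obtain x where x: "x \<in> A n" "d w x < e / 2"
          using near[of "e/2"] e by auto
        have xM: "x \<in> M" and wM: "w \<in> M"
          using x w by (auto simp: A_def)
        have same: "t z = t x" if "z \<in> A n" "d w z < e / 2" for z
        proof -
          have "z \<in> M"
            using that by (auto simp: A_def)
          then have "d z x < e"
            using triangle[of z w x] x that xM wM by (auto simp: commute)
          then show ?thesis
            using eq[OF that(1) x(1)] by (simp add: e_def)
        qed
        have tx: "t x \<in> M"
          using t(1)[OF xM] by (auto simp: N_def)
        have "d x w < e"
          using x(2) e by (simp add: commute)
        then have "d x w < 1 / real (Suc n)"
          by (simp add: e_def)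
        then have wt: "d w (t x) < \<delta>" and l1: "(t x, t w) \<notin> r - Id"
          using x(1) wM less[OF x(1) wM] by (auto simp: A_def)
        have l2: "(t w, t x) \<notin> r - Id"
        proof
          assume l: "(t w, t x) \<in> r - Id"
          have tw: "t w \<in> M" "d w (t w) < \<delta>"
            using t(1)[OF wM] by (auto simp: N_def)
          define s where "s = min (e / 2) (\<delta> - d w (t w))"
          obtain z where z: "z \<in> A n" "d w z < s"
            using near[of s] e tw by (auto simp: s_def)
          have zM: "z \<in> M"
            using z by (auto simp: A_def)
          have "t z = t x"
            using same z by (auto simp: s_def)
          then have "t w \<notin> N z"
            using t(2)[OF zM] l by auto
          moreover have "d z (t w) < \<delta>"
            using triangle[of z w "t w"] z zM wM tw by (auto simp: s_def commute)
          ultimately show False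
            using tw by (auto simp: N_def)
        qed
        have "t w = t x"
          using tot l1 l2 by blast
        moreover have "d v (t x) < \<delta>" if v: "v \<in> M" "d w v < e" for v
        proof -
          obtain z where z: "z \<in> A n" "d w z < min (e / 2) (e - d w v)"
            using near[of "min (e / 2) (e - d w v)"] e v by auto
          have zM: "z \<in> M"
            using z by (auto simp: A_def)
          have "d z v < 1 / real (Suc n)"
            using triangle[of z w v] z zM wM v by (auto simp: e_def commute)
          then show ?thesis
            using z(1) v(1) same[OF z(1)] z(2) by (auto simp: A_def)
        qed
        ultimately have "w \<in> A n"
          using wM by (auto simp: A_def e_def)
        then show False
          using w by auto
      qed
    qed
  next
    show "A m \<subseteq> A n" if "m \<le> n" for m n
    proof -
      have "1 / real (Suc n) \<le> 1 / real (Suc m)"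
        using that by (simp add: frac_le)
      then show ?thesis
        by (force simp: A_def)
    qed
  next
    have "\<exists>n. x \<in> A n" if x: "x \<in> M" for x
    proof -
      have tx: "t x \<in> M" "d x (t x) < \<delta>"
        using t(1)[OF x] by (auto simp: N_def)
      then obtain n where n: "1 / real (Suc n) < \<delta> - d x (t x)"
        using nat_approx_posE[of "\<delta> - d x (t x)"] by auto
      have "d v (t x) < \<delta>" if "v \<in> M" "d x v < 1 / real (Suc n)" for v
        using triangle[of v x "t x"] n tx x that by (auto simp: commute)
      then show ?thesis
        using x by (auto simp: A_def)
    qed
    then show "(\<Union>n. A n) = M"
      by (auto simp: A_def)
  next
    fix n x assume x: "x \<in> A n"
    then have "x \<in> M"
      by (auto simp: A_def)
    then show "\<exists>G. openin mtopology G \<and> x \<in> G \<and> (\<forall>z\<in>G \<inter> A n. t z = t x)"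
      using eq[OF x] by (intro exI[of _ "mball x (1 / real (Suc n))"]) force
  next
    show "t x \<in> M \<and> d x (t x) < \<delta>" if "x \<in> M" for x
      using t(1)[OF that] by (auto simp: N_def)
  qed
qed

text \<open>The index \<open>i\<close> encodes a scale \<open>1/(j + 1)\<close> and a member
  \<open>A j n\<close> of the cover at that scale. Each tag is closer to its point than the scale,
  so below half the least distance in \<open>K\<close> the tags are distinct, and the ascending sets
  \<open>A j n\<close> eventually contain \<open>K\<close>.\<close>

lemma metrizable_tagged_closed_cover:
  assumes "metrizable_space X"
  obtains A :: "nat \<Rightarrow> 'a set" and t :: "nat \<Rightarrow> 'a \<Rightarrow> 'a" where
    "\<forall>i. closedin X (A i)"
    "\<forall>i. \<forall>x\<in>A i. \<exists>G. openin X G \<and> x \<in> G \<and> (\<forall>z\<in>G \<inter> A i. t i z = t i x)"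
    "\<forall>K. finite K \<longrightarrow> K \<subseteq> topspace X \<longrightarrow> (\<exists>i. K \<subseteq> A i \<and> inj_on (t i) K)"
proof -
  obtain M d where M: "Metric_space M d" "X = Metric_space.mtopology M d"
    using assms by (auto simp: metrizable_space_def)
  interpret Metric_space M d
    by (rule M)
  have "\<exists>A t. (\<forall>n. closedin X (A n)) \<and> (\<forall>m n. m \<le> n \<longrightarrow> A m \<subseteq> A n) \<and> (\<Union>n::nat. A n) = M \<and>
    (\<forall>n. \<forall>x\<in>A n. \<exists>G. openin X G \<and> x \<in> G \<and> (\<forall>z\<in>G \<inter> A n. t z = t x)) \<and>
    (\<forall>x\<in>M. t x \<in> M \<and> d x (t x) < 1 / real (Suc j))" for j
  proof -
    have "0 < 1 / real (Suc j)"
      by simp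
    then show ?thesis
    proof (rule tagged_closed_cover_scale)
      fix A t assume At: "\<And>n::nat. closedin mtopology (A n)"
        "\<And>m n. m \<le> n \<Longrightarrow> A m \<subseteq> A n" "(\<Union>n. A n) = M"
        "\<And>n x. x \<in> A n \<Longrightarrow> \<exists>G. openin mtopology G \<and> x \<in> G \<and> (\<forall>z\<in>G \<inter> A n. t z = t x)"
        "\<And>x. x \<in> M \<Longrightarrow> t x \<in> M \<and> d x (t x) < 1 / real (Suc j)"
      show ?thesis
        unfolding M(2) by (rule exI[of _ A], rule exI[of _ t], intro conjI allI impI ballI)
          (use At in blast)+
    qed
  qed
  then obtain A t where A: "\<And>j n. closedin X (A j n)" "\<And>j m n. m \<le> n \<Longrightarrow> A j m \<subseteq> A j n"
      "\<And>j. (\<Union>n::nat. A j n) = M"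
      "\<And>j n x. x \<in> A j n \<Longrightarrow> \<exists>G. openin X G \<and> x \<in> G \<and> (\<forall>z\<in>G \<inter> A j n. t j z = t j x)"
      "\<And>j x. x \<in> M \<Longrightarrow> t j x \<in> M \<and> d x (t j x) < 1 / real (Suc j)"
    by metis
  show ?thesis
  proof (rule that; intro allI ballI impI)
    show "closedin X (case prod_decode i of (j, n) \<Rightarrow> A j n)" for i
      using A(1) by (auto split: prod.split)
  next
    fix i x assume "x \<in> (case prod_decode i of (j, n) \<Rightarrow> A j n)"
    then show "\<exists>G. openin X G \<and> x \<in> G \<and> (\<forall>z\<in>G \<inter> (case prod_decode i of (j, n) \<Rightarrow> A j n).
        t (fst (prod_decode i)) z = t (fst (prod_decode i)) x)"
      using A(4) by (auto split: prod.splits)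
  next
    fix K assume K: "finite K" "K \<subseteq> topspace X"
    then have KM: "K \<subseteq> M"
      by (simp add: M(2))
    define D where "D = (\<lambda>(x,y). d x y) ` {(x,y) \<in> K \<times> K. x \<noteq> y}"
    have "finite {(x,y) \<in> K \<times> K. x \<noteq> y}"
      by (rule finite_subset[of _ "K \<times> K"]) (use K in auto)
    then have fD: "finite D" and D0: "\<And>s. s \<in> D \<Longrightarrow> s > 0"
      using KM by (auto simp: D_def subset_iff)
    \<comment> \<open>The inserted 1 handles a \<open>K\<close> with at most one point, for which
      \<open>D\<close> is empty.\<close>
    define \<delta> where "\<delta> = Min (insert 1 D)"
    have \<delta>: "\<delta> > 0" "\<And>s. s \<in> D \<Longrightarrow> \<delta> \<le> s"
      using fD D0 by (auto simp: \<delta>_def)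
    obtain j where j: "1 / real (Suc j) < \<delta> / 2"
      using nat_approx_posE[of "\<delta> / 2"] \<delta> by auto
    have inj: "inj_on (t j) K"
    proof (rule inj_onI, rule ccontr)
      fix x y assume xy: "x \<in> K" "y \<in> K" "t j x = t j y" "x \<noteq> y"
      then have "d x y \<in> D"
        by (force simp: D_def)
      then have "\<delta> \<le> d x y"
        by (rule \<delta>(2))
      moreover have "d x y \<le> d x (t j x) + d y (t j x)"
        using triangle[of x "t j x" y] A(5)[of x j] xy KM by (auto simp: commute)
      moreover have "d x (t j x) < 1 / real (Suc j)" "d y (t j x) < 1 / real (Suc j)"
        using A(5)[of x j] A(5)[of y j] xy KM by auto
      ultimately show False
        using j by linarith
    qed
    have "\<exists>n. K \<subseteq> A j n"
      using K(1) KM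
    proof (induction K)
      case (insert x K)
      then obtain n where n: "K \<subseteq> A j n"
        by auto
      obtain m where m: "x \<in> A j m"
        using insert A(3)[of j] by auto
      have "insert x K \<subseteq> A j (max m n)"
        using n m A(2)[of m "max m n" j] A(2)[of n "max m n" j] by auto
      then show ?case ..
    qed auto
    then obtain n where "K \<subseteq> A j n" ..
    then show "\<exists>i. K \<subseteq> (case prod_decode i of (j, n) \<Rightarrow> A j n) \<and> inj_on (t (fst (prod_decode i))) K"
      using inj by (intro exI[of _ "prod_encode (j, n)"]) auto
  qed
qed

section \<open>Controlling sets\<close>

lemma urysohn_bounded:
  assumes "normal_space Y" "closedin Y A" "closedin Y B" "disjnt A B" "0 \<le> c"
  obtains g where "g \<in> Cstar_fun Y" "\<And>y. y \<in> A \<Longrightarrow> g y = 0" "\<And>y. y \<in> B \<Longrightarrow> g y = c"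
    "\<And>y. y \<in> topspace Y \<Longrightarrow> \<bar>g y\<bar> \<le> c"
proof -
  obtain \<phi> where \<phi>: "continuous_map Y (top_of_set {0..c}) \<phi>" "\<phi> ` A \<subseteq> {0}" "\<phi> ` B \<subseteq> {c}"
    using Urysohn_lemma[OF assms] by auto
  have 1: "continuous_map Y euclideanreal \<phi>" "\<And>y. y \<in> topspace Y \<Longrightarrow> 0 \<le> \<phi> y \<and> \<phi> y \<le> c"
    using \<phi>(1) by (auto simp: continuous_map_in_subtopology)
  have sub: "A \<subseteq> topspace Y" "B \<subseteq> topspace Y"
    using assms closedin_subset by auto
  have c: "continuous_map Y euclideanreal (restrict \<phi> (topspace Y))"
    using 1(1) by (rule continuous_map_eq) auto
  have b: "bounded (restrict \<phi> (topspace Y) ` topspace Y)"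
    unfolding bounded_iff using 1(2) by (intro exI[of _ c]) auto
  show ?thesis
  proof
    show "restrict \<phi> (topspace Y) \<in> Cstar_fun Y"
      using c b by (auto simp: Cstar_fun_def C_fun_def)
  qed (use sub \<phi> 1 in \<open>auto simp: image_subset_iff\<close>)
qed

lemma norm_bounded_seqI:
  assumes "\<And>n. g n \<in> Cstar_fun Y" "\<And>n y. y \<in> topspace Y \<Longrightarrow> \<bar>g n y\<bar> \<le> c" "c > 0"
  shows "norm_bounded_seq Y g"
  unfolding norm_bounded_seq_def sup_norm_def
  using assms by (auto intro!: exI[of _ c] cSUP_least)

lemma norm_bounded_seqD:
  assumes "norm_bounded_seq X f"
  obtains M where "M > 0" "\<And>n x. x \<in> topspace X \<Longrightarrow> \<bar>f n x\<bar> \<le> M"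
proof -
  obtain M where M: "M > 0" "\<And>n. sup_norm X (f n) \<le> M" "\<And>n. f n \<in> Cstar_fun X"
    using assms by (auto simp: norm_bounded_seq_def)
  have "\<bar>f n x\<bar> \<le> M" if x: "x \<in> topspace X" for n x
  proof -
    have "bdd_above ((\<lambda>x. \<bar>f n x\<bar>) ` topspace X)"
      using M(3)[of n] by (force simp: Cstar_fun_def bounded_iff bdd_above_def)
    then have "\<bar>f n x\<bar> \<le> (SUP x\<in>topspace X. \<bar>f n x\<bar>)"
      using x by (rule cSUP_upper2) auto
    then show ?thesis
      using M(2)[of n] x by (auto simp: sup_norm_def split: if_splits)
  qed
  then show ?thesis
    using that M(1) by blast
qed

lemma openin_diff_less:
  assumes "f \<in> C_fun Z" "g \<in> C_fun Z"
  shows "openin Z {z \<in> topspace Z. \<bar>f z - g z\<bar> < c}"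
    and "openin Z {z \<in> topspace Z. c < \<bar>f z - g z\<bar>}"
proof -
  have c: "continuous_map Z euclideanreal (\<lambda>z. \<bar>f z - g z\<bar>)"
    using assms by (intro continuous_map_real_abs continuous_map_diff) (auto simp: C_fun_def)
  show "openin Z {z \<in> topspace Z. \<bar>f z - g z\<bar> < c}"
    using openin_continuous_map_preimage[OF c, of "{..<c}"] by auto
  show "openin Z {z \<in> topspace Z. c < \<bar>f z - g z\<bar>}"
    using openin_continuous_map_preimage[OF c, of "{c<..}"] by auto
qed

section \<open>Existence, intersection and openness properties of controlling sets\<close>

locale uniform_surjection =
  fixes X :: "'a topology" and Y :: "'b topology" and DX DY T
  assumes X: "T4_space X" and Y: "T4_space Y"
    and DX: "DX = C_fun X \<or> DX = Cstar_fun X" and DY: "DY = C_fun Y \<or> DY = Cstar_fun Y"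
    and image: "T ` DX = DY" and uniformly_continuous: "uniformly_continuous_Dp X DX Y DY T"
    and inversely_bounded: "inversely_bounded X Y T"
begin

text \<open>The strict premise and the weak conclusion make failure of control an open condition: a
  failing pair has \<open>\<bar>f - g\<bar> < 1\<close> on an open subset of \<open>X\<close> and
  violates the bound on an open subset of \<open>Y\<close>.\<close>

definition controls :: "'b \<Rightarrow> 'a set \<Rightarrow> real \<Rightarrow> bool" where
  "controls y K p \<longleftrightarrow>
    (\<forall>f\<in>DX. \<forall>g\<in>DX. (\<forall>x\<in>K. \<bar>f x - g x\<bar> < 1) \<longrightarrow> \<bar>T f y - T g y\<bar> \<le> p)"

lemma controlsD:
  assumes "controls y K p" "f \<in> DX" "g \<in> DX" "\<And>x. x \<in> K \<Longrightarrow> \<bar>f x - g x\<bar> < 1"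
  shows "\<bar>T f y - T g y\<bar> \<le> p"
  using assms unfolding controls_def by blast

lemma controls_mono:
  assumes "controls y K p" "K \<subseteq> K'" "p \<le> p'"
  shows "controls y K' p'"
  unfolding controls_def
proof (intro ballI impI)
  fix f g assume "f \<in> DX" "g \<in> DX" "\<forall>x\<in>K'. \<bar>f x - g x\<bar> < 1"
  then have "\<bar>T f y - T g y\<bar> \<le> p"
    using assms by (intro controlsD[OF assms(1)]) auto
  then show "\<bar>T f y - T g y\<bar> \<le> p'"
    using assms(3) by linarith
qed

lemma Cstar_fun_subset_DX: "Cstar_fun X \<subseteq> DX" and Cstar_fun_subset_DY: "Cstar_fun Y \<subseteq> DY"
  using DX DY by (auto simp: Cstar_fun_def)

lemma DX_subset_C_fun: "DX \<subseteq> C_fun X" and DY_subset_C_fun: "DY \<subseteq> C_fun Y"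
  using DX DY by (auto simp: Cstar_fun_def)

lemma T_mem_DY: "f \<in> DX \<Longrightarrow> T f \<in> DY"
  using image by auto

lemma normal_X: "normal_space X"
  using X by (simp add: T4_space_def)

lemma normal_Y: "normal_space Y"
  using Y by (simp add: T4_space_def)

lemma closedin_finite_X: "finite F \<Longrightarrow> F \<subseteq> topspace X \<Longrightarrow> closedin X F"
  using X by (auto simp: T4_space_def closedin_Hausdorff_finite)

lemma closedin_finite_Y: "finite F \<Longrightarrow> F \<subseteq> topspace Y \<Longrightarrow> closedin Y F"
  using Y by (auto simp: T4_space_def closedin_Hausdorff_finite)

lemma modulus:
  assumes y: "y \<in> topspace Y" and \<epsilon>: "\<epsilon> > 0"
  obtains E \<delta> where "finite E" "E \<subseteq> topspace X" "\<delta> > 0"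
    "\<And>f g. f \<in> DX \<Longrightarrow> g \<in> DX \<Longrightarrow> (\<And>x. x \<in> E \<Longrightarrow> \<bar>f x - g x\<bar> < \<delta>) \<Longrightarrow> \<bar>T f y - T g y\<bar> < \<epsilon>"
proof -
  let ?U = "{h \<in> DY. \<bar>h y\<bar> < \<epsilon>}"
  have "openin (pointwise_topology Y DY) ?U" "zero_fun Y \<in> ?U"
    using openin_pointwise_ball[OF DY y] zero_fun_mem[of Y] Cstar_fun_subset_DY \<epsilon> y
    by (auto simp: zero_fun_def)
  then obtain V where V: "openin (pointwise_topology X DX) V" "zero_fun X \<in> V"
      "\<And>f g. f \<in> DX \<Longrightarrow> g \<in> DX \<Longrightarrow> diff_fun X f g \<in> V \<Longrightarrow> diff_fun Y (T f) (T g) \<in> ?U"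
    using uniformly_continuous unfolding uniformly_continuous_Dp_def by meson
  obtain E \<delta> where E: "finite E" "E \<subseteq> topspace X" "\<delta> > 0"
    "\<And>f. f \<in> DX \<Longrightarrow> f \<in> extensional (topspace X) \<Longrightarrow> (\<And>x. x \<in> E \<Longrightarrow> \<bar>f x\<bar> < \<delta>) \<Longrightarrow> f \<in> V"
    using pointwise_nhd_zero[OF V(1,2)] by metis
  show ?thesis
  proof
    fix f g assume fg: "f \<in> DX" "g \<in> DX" "\<And>x. x \<in> E \<Longrightarrow> \<bar>f x - g x\<bar> < \<delta>"
    have "diff_fun X f g \<in> V"
    proof (rule E(4))
      show "diff_fun X f g \<in> DX"
        using diff_fun_mem[OF DX] fg by blast
      show "diff_fun X f g \<in> extensional (topspace X)"
        by (simp add: diff_fun_def)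
      show "\<bar>diff_fun X f g x\<bar> < \<delta>" if "x \<in> E" for x
        using fg(3)[OF that] E(2) that by (auto simp: diff_fun_def)
    qed
    then show "\<bar>T f y - T g y\<bar> < \<epsilon>"
      using V(3)[OF fg(1,2)] y by (auto simp: diff_fun_def)
  qed (use E in auto)
qed

text \<open>The segment from \<open>f\<close> to \<open>g\<close> is cut into \<open>N\<close>
  steps, each smaller than the modulus for error 1 on \<open>E\<close>; each step moves the value of
  \<open>T\<close> at \<open>y\<close> by less than 1, so \<open>N\<close> is a bound.\<close>

lemma controls_exists:
  assumes y: "y \<in> topspace Y"
  obtains K and p :: nat where "finite K" "K \<subseteq> topspace X" "controls y K p"
proof -
  obtain E \<delta> where E: "finite E" "E \<subseteq> topspace X" "\<delta> > 0"
    and step: "\<And>f g. f \<in> DX \<Longrightarrow> g \<in> DX \<Longrightarrow> (\<And>x. x \<in> E \<Longrightarrow> \<bar>f x - g x\<bar> < \<delta>) \<Longrightarrow> \<bar>T f y - T g y\<bar> < 1"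
    using modulus[OF y zero_less_one] by metis
  obtain n where n: "1 / real (Suc n) < \<delta>"
    using nat_approx_posE[OF E(3)] by auto
  define N where "N = Suc n"
  have N: "1 / real N < \<delta>" "N > 0"
    using n by (auto simp: N_def)
  have "controls y E N"
    unfolding controls_def
  proof (intro ballI impI)
    fix f g assume f: "f \<in> DX" and g: "g \<in> DX" and fg: "\<forall>x\<in>E. \<bar>f x - g x\<bar> < 1"
    define h where "h i = (\<lambda>x\<in>topspace X. f x + real i / real N * (g x - f x))" for i
    have hD: "h i \<in> DX" if "i \<le> N" for i
      unfolding h_def by (rule blend_mem[OF DX g f]) (use that N in auto)
    have "\<bar>T (h i) y - T (h 0) y\<bar> \<le> real i" if "i \<le> N" for i
      using that
    proof (induction i)
      case (Suc i)
      have "\<bar>T (h (Suc i)) y - T (h i) y\<bar> < 1"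
      proof (rule step)
        fix x assume x: "x \<in> E"
        have "h (Suc i) x - h i x = 1 / real N * (g x - f x)"
          using x E(2) by (auto simp: h_def algebra_simps add_divide_distrib diff_divide_distrib)
        then have "\<bar>h (Suc i) x - h i x\<bar> = 1 / real N * \<bar>f x - g x\<bar>"
          by (simp add: abs_mult abs_minus_commute)
        also have "\<dots> \<le> 1 / real N * 1"
          by (rule mult_left_mono) (use fg x in \<open>auto intro: less_imp_le\<close>)
        finally show "\<bar>h (Suc i) x - h i x\<bar> < \<delta>"
          using N by simp
      qed (use hD Suc in auto)
      then show ?case
        using Suc by auto
    qed auto
    then have "\<bar>T (h N) y - T (h 0) y\<bar> \<le> real N"
      by blast
    moreover have "h 0 = f" "h N = g"
      using f g DX_subset_C_fun N
      by (auto simp: h_def C_fun_def fun_eq_iff extensional_def)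
    ultimately show "\<bar>T f y - T g y\<bar> \<le> real N"
      by (simp add: abs_minus_commute)
  qed
  then show ?thesis
    using that E by blast
qed

text \<open>Interpolate by an \<open>h\<close> that equals \<open>f\<close> on \<open>K\<close> and
  \<open>g\<close> on the rest of \<open>K'\<close>. Then \<open>K\<close> compares \<open>f\<close>
  with \<open>h\<close>, and \<open>K'\<close> compares \<open>h\<close> with
  \<open>g\<close>.\<close>

lemma controls_Int:
  assumes K: "finite K" "K \<subseteq> topspace X" and K': "finite K'" "K' \<subseteq> topspace X"
    and y: "controls y K p" "controls y K' p'"
  shows "controls y (K \<inter> K') (p + p')"
  unfolding controls_def
proof (intro ballI impI)
  fix f g assume f: "f \<in> DX" and g: "g \<in> DX" and fg: "\<forall>x\<in>K \<inter> K'. \<bar>f x - g x\<bar> < 1"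
  have "openin X (topspace X - (K' - K))" "K \<subseteq> topspace X - (K' - K)"
    using K K' by (auto intro!: openin_diff closedin_finite_X)
  then obtain h where h: "h \<in> DX" "\<And>x. x \<in> K \<Longrightarrow> h x = f x"
      "\<And>x. x \<in> topspace X - (topspace X - (K' - K)) \<Longrightarrow> h x = g x"
    using blend[OF DX f g normal_X closedin_finite_X[OF K]] by metis
  have "\<bar>T f y - T h y\<bar> \<le> p"
    using controlsD[OF y(1) f h(1)] h(2) by simp
  moreover have "\<bar>T h y - T g y\<bar> \<le> p'"
  proof (rule controlsD[OF y(2) h(1) g])
    fix x assume x: "x \<in> K'"
    show "\<bar>h x - g x\<bar> < 1"
      using x h(2)[of x] h(3)[of x] fg K'(2) by (cases "x \<in> K") auto
  qed
  ultimately show "\<bar>T f y - T g y\<bar> \<le> p + p'"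
    by linarith
qed

text \<open>Control by the empty set would bound the differences of all values of \<open>T\<close>
  at \<open>y\<close>, but every constant function is in the image of \<open>T\<close>.\<close>

lemma not_controls_empty:
  assumes y: "y \<in> topspace Y"
  shows "\<not> controls y {} p"
proof
  assume c: "controls y {} p"
  have const: "\<exists>f\<in>DX. T f = (\<lambda>y\<in>topspace Y. c)" for c
    using Cstar_fun_subset_DY const_mem_Cstar_fun[of c Y] image by (metis imageE subsetD)
  obtain f where f: "f \<in> DX" "T f = (\<lambda>y\<in>topspace Y. 0)"
    using const by blast
  obtain g where g: "g \<in> DX" "T g = (\<lambda>y\<in>topspace Y. \<bar>p\<bar> + 1)"
    using const by blast
  show False
    using controlsD[OF c f(1) g(1)] f(2) g(2) y by simp
qed

text \<open>This replaces a compactness argument in the Stone-Cech compactification of \<open>X\<close>. Up to a small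
  error, \<open>T f y\<close> depends only on the values of \<open>f\<close> on a finite set \<open>E\<close>; points of a controlling
  set away from \<open>E\<close> do not help to control, because \<open>f\<close> may be made equal to \<open>g\<close> there.\<close>
lemma uncontrolled_nhds:
  assumes y: "y \<in> topspace Y" and C: "closedin X C"
    and "finite K" "K \<subseteq> topspace X"
    and "\<And>J. finite J \<Longrightarrow> J \<subseteq> C \<Longrightarrow> card J \<le> m \<Longrightarrow> \<not> controls y (K \<union> J) p"
  obtains U V where "openin X U" "K \<subseteq> U" "openin Y V" "y \<in> V"
    "\<And>y' L. y' \<in> V \<Longrightarrow> finite L \<Longrightarrow> L \<subseteq> C \<Longrightarrow> card (L - U) \<le> m \<Longrightarrow> \<not> controls y' L p"
proof -
  have "\<exists>U V. openin X U \<and> K \<subseteq> U \<and> openin Y V \<and> y \<in> V \<and>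
    (\<forall>y' L. y' \<in> V \<longrightarrow> finite L \<longrightarrow> L \<subseteq> C \<longrightarrow> card (L - U) \<le> m \<longrightarrow> \<not> controls y' L p)"
    using assms(3-)
  proof (induction m arbitrary: K)
    case 0
    then have "\<not> controls y K p"
      using 0(3)[of "{}"] by simp
    then obtain f g where fg: "f \<in> DX" "g \<in> DX" "\<And>x. x \<in> K \<Longrightarrow> \<bar>f x - g x\<bar> < 1" "\<bar>T f y - T g y\<bar> > p"
      by (auto simp: controls_def not_le)
    let ?U = "{x \<in> topspace X. \<bar>f x - g x\<bar> < 1}" and ?V = "{z \<in> topspace Y. p < \<bar>T f z - T g z\<bar>}"
    have U: "openin X ?U"
      using openin_diff_less(1) DX_subset_C_fun fg by blast
    have V: "openin Y ?V"
      using openin_diff_less(2) DY_subset_C_fun T_mem_DY fg by blast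
    have "\<not> controls y' L p" if "y' \<in> ?V" "finite L" "card (L - ?U) \<le> 0" for y' L
    proof
      assume c: "controls y' L p"
      have "L \<subseteq> ?U"
        using that by auto
      then show False
        using controlsD[OF c fg(1,2)] that by force
    qed
    then show ?case
      using U V fg 0 y by (intro exI[of _ ?U] exI[of _ ?V] conjI) auto
  next
    case (Suc m)
    have "\<not> controls y K p"
      using Suc(4)[of "{}"] by simp
    then obtain f g where f: "f \<in> DX" and g: "g \<in> DX"
      and fg: "\<And>x. x \<in> K \<Longrightarrow> \<bar>f x - g x\<bar> < 1" "\<bar>T f y - T g y\<bar> > p"
      by (auto simp: controls_def not_le)
    \<comment> \<open>The tolerance is the excess of the difference over \<open>p\<close>, so
      changing \<open>f\<close> off \<open>E\<close> keeps the difference from \<open>T g y\<close>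
      above \<open>p\<close>.\<close>
    obtain E where E: "finite E" "E \<subseteq> topspace X"
      and free: "\<And>h. h \<in> DX \<Longrightarrow> (\<And>x. x \<in> E \<Longrightarrow> h x = f x) \<Longrightarrow> \<bar>T h y - T f y\<bar> < \<bar>T f y - T g y\<bar> - p"
    proof (rule modulus[OF y, of "\<bar>T f y - T g y\<bar> - p"])
      show "0 < \<bar>T f y - T g y\<bar> - p"
        using fg(2) by simp
    qed (use f in auto)
    \<comment> \<open>The induction hypothesis is applied with \<open>e\<close> moved into
      \<open>K\<close>, which costs one of the \<open>Suc m\<close> free points.\<close>
    define Q where "Q e U V \<longleftrightarrow> openin X U \<and> insert e K \<subseteq> U \<and> openin Y V \<and> y \<in> V \<and>
        (\<forall>y' L. y' \<in> V \<longrightarrow> finite L \<longrightarrow> L \<subseteq> C \<longrightarrow> card (L - U) \<le> m \<longrightarrow> \<not> controls y' L p)"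
      for e U V
    have "\<exists>U V. Q e U V" if e: "e \<in> E \<inter> C" for e
      unfolding Q_def
    proof (rule Suc.IH)
      show "finite (insert e K)" "insert e K \<subseteq> topspace X"
        using Suc.prems E e by auto
      fix J assume J: "finite J" "J \<subseteq> C" "card J \<le> m"
      then have "card (insert e J) \<le> Suc m"
        using card_insert_le_m1 by (metis card_insert_if le_SucI not_less_eq_eq)
      then show "\<not> controls y (insert e K \<union> J) p"
        using Suc.prems(3)[of "insert e J"] J e by (simp add: insert_commute)
    qed
    then obtain U V where Q: "\<And>e. e \<in> E \<inter> C \<Longrightarrow> Q e (U e) (V e)"
      by metis
    then have UV: "\<And>e. e \<in> E \<inter> C \<Longrightarrow> openin X (U e)" "\<And>e. e \<in> E \<inter> C \<Longrightarrow> insert e K \<subseteq> U e"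
      "\<And>e. e \<in> E \<inter> C \<Longrightarrow> openin Y (V e)" "\<And>e. e \<in> E \<inter> C \<Longrightarrow> y \<in> V e"
      by (auto simp: Q_def)
    have UV5: "\<not> controls y' L p"
      if "e \<in> E \<inter> C" "y' \<in> V e" "finite L" "L \<subseteq> C" "card (L - U e) \<le> m" for e y' L
      using Q[OF that(1)] that unfolding Q_def by blast
    define U0 where "U0 = {x \<in> topspace X. \<bar>f x - g x\<bar> < 1}"
    have U0: "openin X U0" "K \<subseteq> U0"
      unfolding U0_def using openin_diff_less(1) DX_subset_C_fun f g fg(1) Suc.prems by blast+
    \<comment> \<open>The function \<open>h\<close> below agrees with \<open>f\<close> on
      \<open>E\<close> and with \<open>g\<close> off \<open>G\<close>. A point of \<open>C\<close>
      outside \<open>G\<close> avoids \<open>U0\<close> and every \<open>U e\<close>.\<close>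
    define G where "G = U0 \<union> (\<Union>e\<in>E \<inter> C. U e) \<union> (topspace X - C)"
    have "openin X G"
      using U0 UV(1) C by (auto simp: G_def intro!: openin_Un openin_Union)
    moreover have "E \<union> K \<subseteq> G"
      using U0 UV(2) E by (auto simp: G_def)
    moreover have "closedin X (E \<union> K)"
      using E Suc.prems by (intro closedin_finite_X) auto
    ultimately obtain h where h: "h \<in> DX" "\<And>x. x \<in> E \<union> K \<Longrightarrow> h x = f x"
      "\<And>x. x \<in> topspace X - G \<Longrightarrow> h x = g x"
      "\<And>x. x \<in> topspace X \<Longrightarrow> \<bar>h x - g x\<bar> \<le> \<bar>f x - g x\<bar>"
      using blend[OF DX f g normal_X, of "E \<union> K" G] by metis
    define U' where "U' = U0 \<inter> (topspace X \<inter> (\<Inter>e\<in>E \<inter> C. U e))"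
    define V0 where "V0 = {z \<in> topspace Y. p < \<bar>T h z - T g z\<bar>}"
    define V' where "V' = V0 \<inter> (topspace Y \<inter> (\<Inter>e\<in>E \<inter> C. V e))"
    have "openin X U'"
      unfolding U'_def by (intro openin_Int U0 openin_Int_Inter) (use UV(1) E in auto)
    moreover have "K \<subseteq> U'"
      using U0 UV(2) Suc.prems by (auto simp: U'_def)
    ultimately have U': "openin X U'" "K \<subseteq> U'" .
    have V0: "openin Y V0"
      unfolding V0_def using openin_diff_less(2) DY_subset_C_fun T_mem_DY g h(1) by blast
    have "\<bar>T h y - T f y\<bar> < \<bar>T f y - T g y\<bar> - p"
      using free h by blast
    then have "y \<in> V0"
      using y by (auto simp: V0_def)
    then have "y \<in> V'"
      using UV(4) y by (auto simp: V'_def)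
    moreover have "openin Y V'"
      unfolding V'_def by (intro openin_Int V0 openin_Int_Inter) (use UV(3) E in auto)
    ultimately have V': "openin Y V'" "y \<in> V'" by auto
    have "\<not> controls y' L p" if y': "y' \<in> V'" and L: "finite L" "L \<subseteq> C" "card (L - U') \<le> Suc m" for y' L
    \<comment> \<open>If a point of \<open>L - U'\<close> lies in some \<open>U e\<close>, at most
      \<open>m\<close> points of \<open>L\<close> lie outside \<open>U e\<close> and the
      neighbourhoods of \<open>e\<close> apply. Otherwise every point of \<open>L\<close> lies in
      \<open>U0\<close> or off \<open>G\<close>, so \<open>h\<close> and \<open>g\<close> are within
      1 on \<open>L\<close>.\<close>
    proof (cases "\<exists>e\<in>E \<inter> C. (L - U') \<inter> U e \<noteq> {}")
      case True
      then obtain e x where e: "e \<in> E \<inter> C" and x: "x \<in> L - U'" "x \<in> U e"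
        by blast
      have "L - U e \<subseteq> (L - U') - {x}"
        using e x by (auto simp: U'_def)
      then have "card (L - U e) \<le> card ((L - U') - {x})"
        using L by (intro card_mono) auto
      also have "\<dots> \<le> m"
        using L x by (subst card_Diff_singleton) auto
      finally show ?thesis
        using UV5[OF e] y' e L by (auto simp: V'_def)
    next
      case False
      show ?thesis
      proof
        assume c: "controls y' L p"
        have "\<bar>T h y' - T g y'\<bar> \<le> p"
        proof (rule controlsD[OF c h(1) g])
          fix x assume x: "x \<in> L"
          have xX: "x \<in> topspace X"
            using x L C closedin_subset by blast
          show "\<bar>h x - g x\<bar> < 1"
          proof (cases "x \<in> U0")
            case True
            then show ?thesis
              using h(4)[OF xX] by (auto simp: U0_def)
          next
            case F: False
            then have "x \<notin> G"
              using False x L by (auto simp: G_def U'_def)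
            then show ?thesis
              using h(3) xX by auto
          qed
        qed
        then show False
          using y' by (auto simp: V'_def V0_def)
      qed
    qed
    then show ?case
      using U' V' by (intro exI[of _ U'] exI[of _ V']) blast
  qed
  then show ?thesis
    using that by blast
qed


text \<open>The case of empty \<open>K\<close>. With \<open>C\<close> the whole space it makes
  levels closed; with \<open>C\<close> the complement of an open set it makes supports lower
  semicontinuous.\<close>

lemma uncontrolled_nhd:
  assumes "y \<in> topspace Y" "closedin X C"
    and "\<And>J. finite J \<Longrightarrow> J \<subseteq> C \<Longrightarrow> card J \<le> q \<Longrightarrow> \<not> controls y J p"
  obtains V where "openin Y V" "y \<in> V"
    "\<And>y' L. y' \<in> V \<Longrightarrow> finite L \<Longrightarrow> L \<subseteq> C \<Longrightarrow> card L \<le> q \<Longrightarrow> \<not> controls y' L p"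
proof (rule uncontrolled_nhds[OF assms(1,2), of "{}" q p])
  fix U V assume V: "openin Y V" "y \<in> V"
    "\<And>y' L. y' \<in> V \<Longrightarrow> finite L \<Longrightarrow> L \<subseteq> C \<Longrightarrow> card (L - U) \<le> q \<Longrightarrow> \<not> controls y' L p"
  show ?thesis
  proof
    fix y' L assume L: "y' \<in> V" "finite L" "L \<subseteq> C" "card L \<le> q"
    then have "card (L - U) \<le> q"
      using card_mono[of L "L - U"] by simp
    then show "\<not> controls y' L p"
      using V(3) L by blast
  qed (use V in auto)
qed (use assms(3) in auto)

section \<open>Levels, regions and unique supports\<close>

definition supports :: "real \<Rightarrow> nat \<Rightarrow> 'b \<Rightarrow> 'a set \<Rightarrow> bool" where
  "supports p q y K \<longleftrightarrow> finite K \<and> K \<subseteq> topspace X \<and> card K \<le> q \<and> controls y K p"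

definition level :: "real \<Rightarrow> nat \<Rightarrow> 'b set" where
  "level p q = {y \<in> topspace Y. \<exists>K. supports p q y K}"

text \<open>The factor 2 comes from \<open>controls_Int\<close>: two different supports of size
  \<open>q\<close> would have a smaller intersection controlling with bound
  \<open>p + p\<close>.\<close>

definition region :: "real \<Rightarrow> nat \<Rightarrow> 'b set" where
  "region p q = level p q - level (2 * p) (q - 1)"

text \<open>Meaningful on \<open>region p q\<close> with \<open>0 \<le> p\<close>, where the support
  is unique.\<close>

definition supp :: "real \<Rightarrow> nat \<Rightarrow> 'b \<Rightarrow> 'a set" where
  "supp p q y = (THE K. supports p q y K)"

lemma closedin_level: "closedin Y (level p q)"
proof -
  have "openin Y (topspace Y - level p q)"
  proof (subst openin_subopen, intro ballI)
    fix y assume y: "y \<in> topspace Y - level p q"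
    have "\<not> controls y J p" if "finite J" "J \<subseteq> topspace X" "card J \<le> q" for J
      using y that by (auto simp: level_def supports_def)
    then obtain V where V: "openin Y V" "y \<in> V"
        "\<And>y' L. y' \<in> V \<Longrightarrow> finite L \<Longrightarrow> L \<subseteq> topspace X \<Longrightarrow> card L \<le> q \<Longrightarrow> \<not> controls y' L p"
      using uncontrolled_nhd[of y "topspace X" q p] y by blast
    have "y' \<notin> level p q" if y': "y' \<in> V" for y'
    proof
      assume "y' \<in> level p q"
      then show False
        using V(3)[OF y'] by (auto simp: level_def supports_def)
    qed
    then have "V \<subseteq> topspace Y - level p q"
      using openin_subset[OF V(1)] by auto
    then show "\<exists>V. openin Y V \<and> y \<in> V \<and> V \<subseteq> topspace Y - level p q"
      using V(1,2) by auto
  qed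
  then show ?thesis
    by (auto simp: closedin_def level_def)
qed

lemma supports_region:
  assumes y: "y \<in> region p q" and p: "0 \<le> p" and K: "supports p q y K" "supports p q y K'"
  shows "card K = q" "K = K'"
proof -
  have no: "\<not> (finite L \<and> L \<subseteq> topspace X \<and> card L < q \<and> controls y L (2 * p))" for L
    using y by (force simp: region_def level_def supports_def)
  have card: "card L = q" if "supports p q y L" for L
    using no[of L] controls_mono[of y L p L "2 * p"] that p by (force simp: supports_def)
  show "card K = q"
    by (rule card[OF K(1)])
  have "controls y (K \<inter> K') (2 * p)"
    using controls_Int[of K K' y p p] K by (simp add: supports_def)
  then have "\<not> card (K \<inter> K') < q"
    using no[of "K \<inter> K'"] K by (auto simp: supports_def)
  moreover have fin: "finite K" "finite K'"
    using K by (auto simp: supports_def)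
  ultimately have "K \<inter> K' = K" "K \<inter> K' = K'"
    using card[OF K(1)] card[OF K(2)] card_mono[of K "K \<inter> K'"] card_mono[of K' "K \<inter> K'"]
    by (intro card_subset_eq; simp)+
  then show "K = K'"
    by simp
qed

lemma supports_supp:
  assumes "y \<in> region p q" "0 \<le> p"
  shows "supports p q y (supp p q y)"
proof -
  obtain K where K: "supports p q y K"
    using assms by (auto simp: region_def level_def)
  show ?thesis
    unfolding supp_def by (rule theI[where P = "supports p q y", OF K]) (rule supports_region(2)[OF assms _ K])
qed

text \<open>By uniqueness no set of at most \<open>q\<close> points avoiding \<open>G\<close>
  controls \<open>y\<close> with bound \<open>p\<close>, and this persists near
  \<open>y\<close>.\<close>

lemma supp_hits_open:
  assumes y: "y \<in> region p q" and p: "0 \<le> p" and G: "openin X G" "supp p q y \<inter> G \<noteq> {}"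
  obtains V where "openin Y V" "y \<in> V" "\<And>y'. y' \<in> V \<inter> region p q \<Longrightarrow> supp p q y' \<inter> G \<noteq> {}"
proof -
  have yY: "y \<in> topspace Y"
    using y by (auto simp: region_def level_def)
  have "\<not> controls y J p" if J: "finite J" "J \<subseteq> topspace X - G" "card J \<le> q" for J
  proof
    assume "controls y J p"
    then have "supports p q y J"
      using J by (auto simp: supports_def)
    then have "J = supp p q y"
      using supports_region(2)[OF y p _ supports_supp[OF y p]] by blast
    then show False
      using G J by auto
  qed
  moreover have "closedin X (topspace X - G)"
    using G by auto
  ultimately obtain V where V: "openin Y V" "y \<in> V"
      "\<And>y' L. y' \<in> V \<Longrightarrow> finite L \<Longrightarrow> L \<subseteq> topspace X - G \<Longrightarrow> card L \<le> q \<Longrightarrow> \<not> controls y' L p"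
    using uncontrolled_nhd[OF yY, of "topspace X - G" q p] by blast
  show ?thesis
  proof
    fix y' assume y': "y' \<in> V \<inter> region p q"
    let ?L = "supp p q y'"
    have L: "supports p q y' ?L"
      using supports_supp p y' by blast
    then show "?L \<inter> G \<noteq> {}"
      using V(3)[of y' ?L] y' L by (auto simp: supports_def)
  qed (use V in auto)
qed

text \<open>The size \<open>q\<close> is minimal over all bounds at once, so no smaller set controls
  \<open>y\<close> with any bound, in particular with twice the chosen one.\<close>

lemma region_cover:
  assumes y: "y \<in> topspace Y"
  obtains p :: nat and q where "q > 0" "y \<in> region p q"
proof -
  define Q where "Q q \<longleftrightarrow> (\<exists>K p. finite K \<and> K \<subseteq> topspace X \<and> controls y K p \<and> card K = q)" for q
  obtain K p where "finite K" "K \<subseteq> topspace X" "controls y K (real p)"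
    by (rule controls_exists[OF y])
  then have "Q (card K)"
    by (auto simp: Q_def)
  then have Q: "Q (LEAST q. Q q)"
    by (rule LeastI)
  have least: "\<not> Q r" if "r < (LEAST q. Q q)" for r
    using that by (rule not_less_Least)
  define q where "q = (LEAST q. Q q)"
  obtain K p where K: "finite K" "K \<subseteq> topspace X" "controls y K p" "card K = q"
    using Q unfolding Q_def q_def by blast
  have "q > 0"
    using K not_controls_empty[OF y] by (cases "K = {}") auto
  \<comment> \<open>Rounding up to natural bounds leaves countably many regions.\<close>
  define n where "n = nat \<lceil>p\<rceil>"
  have "p \<le> real n"
    by (simp add: n_def real_nat_ceiling_ge)
  then have "controls y K (real n)"
    using controls_mono[OF K(3)] by blast
  then have "y \<in> level n q"
    using K y by (auto simp: level_def supports_def)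
  moreover have "y \<notin> level (2 * real n) (q - 1)"
  proof
    assume "y \<in> level (2 * real n) (q - 1)"
    then obtain L where L: "finite L" "L \<subseteq> topspace X" "card L \<le> q - 1" "controls y L (2 * real n)"
      by (auto simp: level_def supports_def)
    then have "Q (card L)" "card L < q"
      using \<open>q > 0\<close> by (auto simp: Q_def)
    then show False
      using least[of "card L"] unfolding q_def[symmetric] by blast
  qed
  ultimately have "y \<in> region (real n) q"
    by (simp add: region_def)
  with \<open>q > 0\<close> show ?thesis
    by (rule that)
qed

section \<open>Pigeonhole arguments from inverse boundedness\<close>

lemma close_preimages:
  assumes g: "norm_bounded_seq Y g" and K: "finite K" "K \<subseteq> topspace X"
  obtains f m n where "\<And>i. f i \<in> DX" "\<And>i. T (f i) = g i" "m < (n::nat)" "\<And>x. x \<in> K \<Longrightarrow> \<bar>f m x - f n x\<bar> < 1"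
proof -
  obtain f where f: "norm_bounded_seq X f" "\<And>i. T (f i) = g i"
    using inversely_bounded g unfolding inversely_bounded_def by metis
  obtain M where M: "M > 0" "\<And>n x. x \<in> topspace X \<Longrightarrow> \<bar>f n x\<bar> \<le> M"
    using norm_bounded_seqD[OF f(1)] by metis
  \<comment> \<open>Integer parts on the finite set \<open>K\<close> take finitely many values
    because the \<open>f i\<close> are uniformly bounded; equal integer parts mean a difference
    below 1.\<close>
  define \<pi> where "\<pi> i = (\<lambda>x\<in>K. \<lfloor>f i x\<rfloor>)" for i
  have "\<pi> i \<in> (\<Pi>\<^sub>E x\<in>K. {\<lfloor>-M\<rfloor>..\<lfloor>M\<rfloor>})" for i
  proof -
    have "-M \<le> f i x \<and> f i x \<le> M" if "x \<in> K" for x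
      using M(2)[of x i] K that by auto
    then show ?thesis
      by (auto simp: \<pi>_def floor_mono)
  qed
  then have "finite (range \<pi>)"
    by (intro finite_subset[of "range \<pi>" "\<Pi>\<^sub>E x\<in>K. {\<lfloor>-M\<rfloor>..\<lfloor>M\<rfloor>}"] finite_PiE) (use K in auto)
  then have "\<not> inj \<pi>"
    using finite_imageD by blast
  then obtain m n where "m \<noteq> n" "\<pi> m = \<pi> n"
    by (auto simp: inj_def)
  then obtain m n where mn: "m < n" "\<pi> m = \<pi> n"
    by (metis linorder_neqE_nat)
  show ?thesis
  proof
    show "f i \<in> DX" for i
      using f(1) Cstar_fun_subset_DX by (auto simp: norm_bounded_seq_def)
    show "\<bar>f m x - f n x\<bar> < 1" if "x \<in> K" for x
    proof -
      have "\<lfloor>f m x\<rfloor> = \<lfloor>f n x\<rfloor>"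
        using fun_cong[OF mn(2), of x] that by (simp add: \<pi>_def)
      then show ?thesis
        by linarith
    qed
  qed (use f mn in auto)
qed

text \<open>For distinct controlled points \<open>y n\<close>, let \<open>g n\<close> vanish at the
  earlier points and be \<open>\<bar>p\<bar> + 1\<close> at \<open>y n\<close>. Two preimages within
  1 on \<open>K\<close> then violate the bound \<open>p\<close> at the earlier of their two
  points.\<close>

lemma finite_controlled:
  assumes K: "finite K" "K \<subseteq> topspace X"
  shows "finite {y \<in> topspace Y. controls y K p}"
proof (rule ccontr)
  assume "infinite {y \<in> topspace Y. controls y K p}"
  then obtain y :: "nat \<Rightarrow> 'b" where inj: "inj y" and y: "range y \<subseteq> {y \<in> topspace Y. controls y K p}"
    using infinite_countable_subset by blast
  define c where "c = \<bar>p\<bar> + 1"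
  have "\<exists>g. g \<in> Cstar_fun Y \<and> (\<forall>i<n. g (y i) = 0) \<and> g (y n) = c \<and> (\<forall>z\<in>topspace Y. \<bar>g z\<bar> \<le> c)" for n
  proof -
    have "y ` {..<n} \<subseteq> topspace Y" "{y n} \<subseteq> topspace Y"
      using y by auto
    then have cl: "closedin Y (y ` {..<n})" "closedin Y {y n}"
      by (auto intro: closedin_finite_Y)
    have dj: "disjnt (y ` {..<n}) {y n}" "0 \<le> c"
      using inj by (auto simp: disjnt_iff inj_eq c_def)
    show ?thesis
      by (rule urysohn_bounded[OF normal_Y cl dj]) auto
  qed
  then obtain g where g: "\<And>n. g n \<in> Cstar_fun Y" "\<And>n i. i < n \<Longrightarrow> g n (y i) = 0" "\<And>n. g n (y n) = c"
      "\<And>n z. z \<in> topspace Y \<Longrightarrow> \<bar>g n z\<bar> \<le> c"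
    by metis
  have "norm_bounded_seq Y g"
    by (rule norm_bounded_seqI[OF g(1,4)]) (auto simp: c_def)
  then obtain f m n where f: "\<And>i. f i \<in> DX" "\<And>i. T (f i) = g i" "m < (n::nat)" "\<And>x. x \<in> K \<Longrightarrow> \<bar>f m x - f n x\<bar> < 1"
    using close_preimages[OF _ K] by metis
  have "controls (y m) K p"
    using y by auto
  then have "\<bar>T (f m) (y m) - T (f n) (y m)\<bar> \<le> p"
    by (rule controlsD[OF _ f(1) f(1) f(4)])
  then show False
    using f(3) by (simp add: f(2) g c_def)
qed

text \<open>The functions separating the points are indexed by the first component of the pairing
  function, so that any two of them differ at infinitely many terms of the sequence; hence it does
  not matter that finitely many terms are lost when passing from \<open>K\<close> to \<open>L n\<close>.\<close>
lemma no_discrete_sequence: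
  fixes y :: "nat \<Rightarrow> 'b"
  assumes inj: "inj y" and closed: "\<And>S. S \<subseteq> range y \<Longrightarrow> closedin Y S"
    and K: "finite K" "K \<subseteq> topspace X" and L: "\<And>n. controls (y n) (L n) p"
    and conv: "\<And>G. openin X G \<Longrightarrow> K \<subseteq> G \<Longrightarrow> \<forall>\<^sub>F n in sequentially. L n \<subseteq> G"
  shows False
proof -
  define c where "c = \<bar>p\<bar> + 1"
  define A where "A k = y ` {n. fst (prod_decode n) = k}" for k
  have "\<exists>g. g \<in> Cstar_fun Y \<and> (\<forall>z\<in>range y - A k. g z = 0) \<and> (\<forall>z\<in>A k. g z = c) \<and>
    (\<forall>z\<in>topspace Y. \<bar>g z\<bar> \<le> c)" for k
  proof -
    have "A k \<subseteq> range y"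
      by (auto simp: A_def)
    then have cl: "closedin Y (range y - A k)" "closedin Y (A k)"
      by (auto intro: closed)
    have dj: "disjnt (range y - A k) (A k)" "0 \<le> c"
      by (auto simp: disjnt_iff c_def)
    show ?thesis
      by (rule urysohn_bounded[OF normal_Y cl dj]) auto
  qed
  then obtain g where g: "\<And>k. g k \<in> Cstar_fun Y" "\<And>k z. z \<in> range y - A k \<Longrightarrow> g k z = 0"
      "\<And>k z. z \<in> A k \<Longrightarrow> g k z = c" "\<And>k z. z \<in> topspace Y \<Longrightarrow> \<bar>g k z\<bar> \<le> c"
    by metis
  have "norm_bounded_seq Y g"
    by (rule norm_bounded_seqI[OF g(1,4)]) (auto simp: c_def)
  then obtain f k l where f: "\<And>i. f i \<in> DX" "\<And>i. T (f i) = g i" "k < (l::nat)" "\<And>x. x \<in> K \<Longrightarrow> \<bar>f k x - f l x\<bar> < 1"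
    using close_preimages[OF _ K] by metis
  define G where "G = {x \<in> topspace X. \<bar>f k x - f l x\<bar> < 1}"
  have "openin X G"
    unfolding G_def using openin_diff_less(1) DX_subset_C_fun f(1) by blast
  moreover have "K \<subseteq> G"
    using f(4) K by (auto simp: G_def)
  ultimately obtain N where N: "\<And>n. n \<ge> N \<Longrightarrow> L n \<subseteq> G"
    using conv unfolding eventually_sequentially by blast
  define n where "n = prod_encode (k, N)"
  have "L n \<subseteq> G"
    using N le_prod_encode_2[of N k] by (simp add: n_def)
  then have "\<bar>T (f k) (y n) - T (f l) (y n)\<bar> \<le> p"
    by (intro controlsD[OF L f(1) f(1)]) (auto simp: G_def)
  moreover have "g k (y n) = c"
    by (rule g(3)) (auto simp: A_def n_def)
  moreover have "g l (y n) = 0"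
    by (rule g(2)) (use f(3) inj in \<open>auto simp: A_def n_def inj_eq\<close>)
  ultimately show False
    by (simp add: f(2) c_def)
qed

end

text \<open>A limit point is approached by a sequence with strictly decreasing distances, which is
  therefore injective. Injectivity provides the distinct points that
  \<open>no_discrete_sequence\<close> requires.\<close>

lemma metrizable_closedin_injective_sequences:
  assumes Q: "metrizable_space Q" and S: "S \<subseteq> topspace Q"
    and seq: "\<And>\<sigma> w. inj \<sigma> \<Longrightarrow> range \<sigma> \<subseteq> S \<Longrightarrow> limitin Q \<sigma> w sequentially \<Longrightarrow> w \<in> S"
  shows "closedin Q S"
proof -
  obtain M d where M: "Metric_space M d" "Q = Metric_space.mtopology M d"
    using Q by (auto simp: metrizable_space_def)
  interpret Metric_space M d
    by (rule M)
  have "w \<in> S" if w: "w \<in> Q derived_set_of S" for w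
  proof -
    obtain \<sigma> where \<sigma>: "range \<sigma> \<subseteq> S - {w}" "decreasing_dist \<sigma> w" "limitin mtopology \<sigma> w sequentially"
      using w unfolding M(2) derived_set_of_sequentially_decreasing_alt by blast
    show ?thesis
    proof (rule seq)
      show "inj \<sigma>"
        using \<sigma>(2) by (rule decreasing_dist_imp_inj)
    qed (use \<sigma> M(2) in auto)
  qed
  then show ?thesis
    using S by (auto simp: closedin_contains_derived_set)
qed

context uniform_surjection
begin

section \<open>Closed pieces and their finite-to-one maps\<close>

text \<open>The pair \<open>A\<close>, \<open>t\<close> is a member of the tagged cover; injectivity
  lets the tags label the points of the support.\<close>

definition tagged_piece :: "'a set \<Rightarrow> ('a \<Rightarrow> 'a) \<Rightarrow> real \<Rightarrow> nat \<Rightarrow> 'b set \<Rightarrow> 'b set" where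
  "tagged_piece A t p q C = {y \<in> C. supp p q y \<subseteq> A \<and> inj_on t (supp p q y)}"

context
  fixes A :: "'a set" and t :: "'a \<Rightarrow> 'a" and p :: real and q :: nat and C :: "'b set"
  assumes A: "closedin X A"
    and t: "\<And>x. x \<in> A \<Longrightarrow> \<exists>G. openin X G \<and> x \<in> G \<and> (\<forall>z\<in>G \<inter> A. t z = t x)"
    and p: "0 \<le> p" and C: "closedin Y C" "C \<subseteq> region p q"
begin

private abbreviation Z where "Z \<equiv> tagged_piece A t p q C"

text \<open>Both failures inside \<open>C\<close> are stable by \<open>supp_hits_open\<close>. A
  support meeting the complement of \<open>A\<close> continues to meet it. Two support points with
  one tag have disjoint neighbourhoods on which the tag is constant in \<open>A\<close>, and nearby
  supports meet both.\<close>

lemma closedin_tagged_piece: "closedin Y Z"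
proof -
  have "openin Y (topspace Y - Z)"
  proof (subst openin_subopen, intro ballI)
    fix y assume y: "y \<in> topspace Y - Z"
    show "\<exists>V. openin Y V \<and> y \<in> V \<and> V \<subseteq> topspace Y - Z"
    proof (cases "y \<in> C")
      case False
      then show ?thesis
        using C(1) y by (intro exI[of _ "topspace Y - C"]) (auto simp: tagged_piece_def)
    next
      case yC: True
      then have yR: "y \<in> region p q"
        using C by auto
      have supp: "supp p q y \<subseteq> topspace X"
        using supports_supp[OF yR p] by (auto simp: supports_def)
      show ?thesis
      proof (cases "supp p q y \<subseteq> A")
        case False
        have "openin X (topspace X - A)" "supp p q y \<inter> (topspace X - A) \<noteq> {}"
          using A False supp by auto
        then obtain V where V: "openin Y V" "y \<in> V"
            "\<And>y'. y' \<in> V \<inter> region p q \<Longrightarrow> supp p q y' \<inter> (topspace X - A) \<noteq> {}"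
          using supp_hits_open[OF yR p] by blast
        have "V \<inter> Z = {}"
          using V(3) C(2) unfolding tagged_piece_def by blast
        then show ?thesis
          using V openin_subset[OF V(1)] by (intro exI[of _ V]) auto
      next
        case True
        then have "\<not> inj_on t (supp p q y)"
          using y yC by (auto simp: tagged_piece_def)
        then obtain x z where xz: "x \<in> supp p q y" "z \<in> supp p q y" "t x = t z" "x \<noteq> z"
          by (auto simp: inj_on_def)
        obtain G where G: "openin X G" "x \<in> G" "\<forall>u\<in>G \<inter> A. t u = t x"
          using t[of x] xz True by blast
        obtain H where H: "openin X H" "z \<in> H" "\<forall>u\<in>H \<inter> A. t u = t z"
          using t[of z] xz True by blast
        have "x \<in> topspace X" "z \<in> topspace X"
          using xz supp by auto
        then obtain G' H' where GH: "openin X G'" "openin X H'" "x \<in> G'" "z \<in> H'" "disjnt G' H'"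
          using X xz(4) unfolding T4_space_def Hausdorff_space_def by metis
        have "openin X (G \<inter> G')" "supp p q y \<inter> (G \<inter> G') \<noteq> {}"
          "openin X (H \<inter> H')" "supp p q y \<inter> (H \<inter> H') \<noteq> {}"
          using G H GH xz by auto
        then obtain V W where V: "openin Y V" "y \<in> V"
            "\<And>y'. y' \<in> V \<inter> region p q \<Longrightarrow> supp p q y' \<inter> (G \<inter> G') \<noteq> {}"
          and W: "openin Y W" "y \<in> W"
            "\<And>y'. y' \<in> W \<inter> region p q \<Longrightarrow> supp p q y' \<inter> (H \<inter> H') \<noteq> {}"
          using supp_hits_open[OF yR p, of "G \<inter> G'"] supp_hits_open[OF yR p, of "H \<inter> H'"]
          by metis
        have "False" if y': "y' \<in> V \<inter> W" "y' \<in> Z" for y'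
        proof -
          have R: "y' \<in> region p q" "supp p q y' \<subseteq> A" "inj_on t (supp p q y')"
            using y' C(2) by (auto simp: tagged_piece_def)
          obtain u where u: "u \<in> supp p q y'" "u \<in> G" "u \<in> G'"
            using V(3)[of y'] y' R by blast
          obtain v where v: "v \<in> supp p q y'" "v \<in> H" "v \<in> H'"
            using W(3)[of y'] y' R by blast
          have "u \<noteq> v"
            using GH(5) u v by (auto simp: disjnt_iff)
          moreover have "t u = t x" "t v = t z"
            using G(3) H(3) u v R(2) by blast+
          then have "t u = t v"
            using xz(3) by simp
          ultimately show False
            using R(3) u v by (auto simp: inj_on_def)
        qed
        then have "V \<inter> W \<subseteq> topspace Y - Z"
          using openin_subset[OF V(1)] by blast
        moreover have "openin Y (V \<inter> W)"
          using V W by auto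
        ultimately show ?thesis
          using V(2) W(2) by blast
      qed
    qed
  qed
  moreover have "Z \<subseteq> topspace Y"
    using C closedin_subset by (auto simp: tagged_piece_def)
  ultimately show ?thesis
    by (simp add: closedin_def)
qed

text \<open>The tags occurring on the support of a point of a piece form a locally constant finite set,
  so any choice of enumerations of the sets of tags enumerates the supports continuously.\<close>
private definition enum :: "'a set \<Rightarrow> nat \<Rightarrow> 'a" where
  "enum S = (SOME b. bij_betw b {..<q} S)"

private definition \<psi> :: "'b \<Rightarrow> nat \<Rightarrow> 'a" where
  "\<psi> y = (\<lambda>i\<in>{..<q}. inv_into (supp p q y) t (enum (t ` supp p q y) i))"

lemma bij_betw_enum:
  assumes "finite S" "card S = q"
  shows "bij_betw (enum S) {..<q} S"
proof -
  have "\<exists>b. bij_betw b {..<q} S"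
    using ex_bij_betw_nat_finite[OF assms(1)] assms(2) by (simp add: lessThan_atLeast0)
  then show ?thesis
    unfolding enum_def by (rule someI_ex)
qed

lemma tagged_piece_facts:
  assumes y: "y \<in> Z"
  shows "y \<in> region p q" "y \<in> topspace Y" "finite (supp p q y)" "supp p q y \<subseteq> topspace X"
    "card (supp p q y) = q" "controls y (supp p q y) p" "supp p q y \<subseteq> A" "inj_on t (supp p q y)"
    "card (t ` supp p q y) = q"
proof -
  show y': "y \<in> region p q" "supp p q y \<subseteq> A" "inj_on t (supp p q y)" "y \<in> topspace Y"
    using y C closedin_subset[OF C(1)] by (auto simp: tagged_piece_def)
  show "finite (supp p q y)" "supp p q y \<subseteq> topspace X" "controls y (supp p q y) p"
    using supports_supp[OF y'(1) p] by (auto simp: supports_def)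
  show "card (supp p q y) = q"
    by (rule supports_region(1)[OF y'(1) p supports_supp[OF y'(1) p] supports_supp[OF y'(1) p]])
  then show "card (t ` supp p q y) = q"
    using y'(3) by (simp add: card_image)
qed

lemma t_\<psi>:
  assumes y: "y \<in> Z" and i: "i < q"
  shows "\<psi> y i \<in> supp p q y" "t (\<psi> y i) = enum (t ` supp p q y) i"
proof -
  have "enum (t ` supp p q y) i \<in> t ` supp p q y"
    using bij_betw_enum[of "t ` supp p q y"] tagged_piece_facts[OF y] i
    by (auto simp: bij_betw_def)
  then show "\<psi> y i \<in> supp p q y" "t (\<psi> y i) = enum (t ` supp p q y) i"
    using i by (auto simp: \<psi>_def inv_into_into f_inv_into_f)
qed

lemma \<psi>_image:
  assumes y: "y \<in> Z"
  shows "\<psi> y ` {..<q} = supp p q y"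
proof
  show "\<psi> y ` {..<q} \<subseteq> supp p q y"
    using t_\<psi>[OF y] by auto
  show "supp p q y \<subseteq> \<psi> y ` {..<q}"
  proof
    fix x assume x: "x \<in> supp p q y"
    have "enum (t ` supp p q y) ` {..<q} = t ` supp p q y"
      using bij_betw_enum[of "t ` supp p q y"] tagged_piece_facts(3,9)[OF y]
      by (simp add: bij_betw_def)
    then have "t x \<in> enum (t ` supp p q y) ` {..<q}"
      using x by simp
    then obtain i where i: "i < q" "t x = enum (t ` supp p q y) i"
      by auto
    have "t (\<psi> y i) = t x"
      using t_\<psi>(2)[OF y i(1)] i(2) by simp
    then have "\<psi> y i = x"
      using inj_onD[OF tagged_piece_facts(8)[OF y]] t_\<psi>(1)[OF y i(1)] x by blast
    then show "x \<in> \<psi> y ` {..<q}"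
      using i by auto
  qed
qed

text \<open>Near \<open>y\<close> every tag of the support of \<open>y\<close> recurs; as both tag
  sets have \<open>q\<close> elements, they coincide and have the same enumeration. So
  \<open>\<psi> y' i\<close> is the only support point with the tag of \<open>\<psi> y i\<close>,
  and one such point lies in \<open>G\<close>.\<close>

lemma \<psi>_locally:
  assumes y: "y \<in> Z" and i: "i < q" and G: "openin X G" "\<psi> y i \<in> G"
  obtains V where "openin Y V" "y \<in> V" "\<And>y'. y' \<in> V \<inter> Z \<Longrightarrow> \<psi> y' i \<in> G"
proof -
  note f = tagged_piece_facts[OF y]
  have "\<exists>V. openin Y V \<and> y \<in> V \<and>
      (\<forall>y'\<in>V \<inter> Z. \<exists>x'\<in>supp p q y'. t x' = t x \<and> (x = \<psi> y i \<longrightarrow> x' \<in> G))"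
    if x: "x \<in> supp p q y" for x
  proof -
    obtain H where H: "openin X H" "x \<in> H" "\<forall>z\<in>H \<inter> A. t z = t x"
      using t[of x] x f(7) by blast
    \<comment> \<open>Only the point in position \<open>i\<close> has to stay in \<open>G\<close>;
      the others merely have to reproduce their tags.\<close>
    define H' where "H' = (if x = \<psi> y i then H \<inter> G else H)"
    have "openin X H'" "supp p q y \<inter> H' \<noteq> {}"
      using H G x by (auto simp: H'_def)
    then obtain V where V: "openin Y V" "y \<in> V"
        "\<And>y'. y' \<in> V \<inter> region p q \<Longrightarrow> supp p q y' \<inter> H' \<noteq> {}"
      using supp_hits_open[OF f(1) p] by metis
    have "\<exists>x'\<in>supp p q y'. t x' = t x \<and> (x = \<psi> y i \<longrightarrow> x' \<in> G)" if y': "y' \<in> V \<inter> Z" for y'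
    proof -
      have "y' \<in> V \<inter> region p q" and A': "supp p q y' \<subseteq> A"
        using y' tagged_piece_facts by blast+
      then obtain x' where "x' \<in> supp p q y'" "x' \<in> H'"
        using V(3) by blast
      then show ?thesis
        using A' H(3) by (intro bexI[of _ x']) (auto simp: H'_def split: if_splits)
    qed
    then show ?thesis
      using V by blast
  qed
  then obtain V where V: "\<And>x. x \<in> supp p q y \<Longrightarrow> openin Y (V x) \<and> y \<in> V x \<and>
      (\<forall>y'\<in>V x \<inter> Z. \<exists>x'\<in>supp p q y'. t x' = t x \<and> (x = \<psi> y i \<longrightarrow> x' \<in> G))"
    by metis
  define W where "W = topspace Y \<inter> (\<Inter>x\<in>supp p q y. V x)"
  show ?thesis
  proof
    show "openin Y W"
      unfolding W_def by (rule openin_Int_Inter) (use f(3) V in auto)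
    show "y \<in> W"
      using V f(2) by (auto simp: W_def)
    fix y' assume y': "y' \<in> W \<inter> Z"
    then have y'Z: "y' \<in> Z"
      by simp
    note f' = tagged_piece_facts[OF y'Z]
    have near: "\<exists>x'\<in>supp p q y'. t x' = t x \<and> (x = \<psi> y i \<longrightarrow> x' \<in> G)" if "x \<in> supp p q y" for x
      using V[OF that] y' that by (auto simp: W_def)
    then have "t ` supp p q y \<subseteq> t ` supp p q y'"
      by (metis image_subsetI imageI)
    then have eq: "t ` supp p q y = t ` supp p q y'"
      using f(9) f'(3,9) by (intro card_subset_eq) auto
    obtain x' where x': "x' \<in> supp p q y'" "t x' = t (\<psi> y i)" "x' \<in> G"
      using near[OF t_\<psi>(1)[OF y i]] by blast
    have "t (\<psi> y' i) = t x'"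
      using t_\<psi>(2)[OF y'Z i] t_\<psi>(2)[OF y i] eq x'(2) by simp
    then have "\<psi> y' i = x'"
      using f'(8) x'(1) t_\<psi>(1)[OF y'Z i] by (auto simp: inj_on_def)
    then show "\<psi> y' i \<in> G"
      using x' by simp
  qed
qed

private abbreviation Q where "Q \<equiv> product_topology (\<lambda>i. X) {..<q}"

lemma \<psi>_mem: "y \<in> Z \<Longrightarrow> \<psi> y \<in> topspace Q"
  using t_\<psi>(1)[of y] tagged_piece_facts(4)[of y] by (auto simp: PiE_iff \<psi>_def[of y])

lemma continuous_map_\<psi>: "continuous_map (subtopology Y Z) Q \<psi>"
  unfolding continuous_map_componentwise
proof (intro conjI ballI)
  show "\<psi> ` topspace (subtopology Y Z) \<subseteq> extensional {..<q}"
    by (auto simp: \<psi>_def)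
  fix i assume "i \<in> {..<q}"
  then have i: "i < q"
    by simp
  show "continuous_map (subtopology Y Z) X (\<lambda>y. \<psi> y i)"
    unfolding continuous_map_eq_topcontinuous_at topcontinuous_at_def
  proof (intro ballI conjI allI impI)
    show "(\<lambda>y. \<psi> y i) \<in> topspace (subtopology Y Z) \<rightarrow> topspace X"
      using t_\<psi>(1)[OF _ i] tagged_piece_facts(4) by auto
  next
    fix y G assume y: "y \<in> topspace (subtopology Y Z)" and G: "openin X G \<and> \<psi> y i \<in> G"
    then have yZ: "y \<in> Z"
      by simp
    obtain V where V: "openin Y V" "y \<in> V" "\<And>y'. y' \<in> V \<inter> Z \<Longrightarrow> \<psi> y' i \<in> G"
      using \<psi>_locally[OF yZ i] G by metis
    have "openin (subtopology Y Z) (V \<inter> Z)"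
      using V(1) by (auto simp: openin_subtopology)
    then show "\<exists>U. openin (subtopology Y Z) U \<and> y \<in> U \<and> (\<forall>y'\<in>U. \<psi> y' i \<in> G)"
      using V yZ by blast
  qed auto
qed

text \<open>All points of a fibre are controlled by the same finite set, the coordinates of
  \<open>w\<close>.\<close>

lemma finite_fibres_\<psi>:
  assumes w: "w \<in> topspace Q"
  shows "finite {y \<in> Z. \<psi> y = w}"
proof (rule finite_subset)
  show "{y \<in> Z. \<psi> y = w} \<subseteq> {y \<in> topspace Y. controls y (w ` {..<q}) p}"
    using tagged_piece_facts \<psi>_image by auto
  show "finite {y \<in> topspace Y. controls y (w ` {..<q}) p}"
    by (rule finite_controlled) (use w in auto)
qed

lemma closed_map_\<psi>:
  assumes metr: "metrizable_space X"
  shows "closed_map (subtopology Y Z) Q \<psi>"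
  unfolding closed_map_def
proof (intro allI impI)
  fix D assume "closedin (subtopology Y Z) D"
  then have D: "closedin Y D" "D \<subseteq> Z"
    using closedin_closed_subtopology[OF closedin_tagged_piece] by auto
  have Q: "metrizable_space Q"
    using metr by (simp add: metrizable_space_product_topology)
  show "closedin Q (\<psi> ` D)"
  proof (rule metrizable_closedin_injective_sequences[OF Q])
    show "\<psi> ` D \<subseteq> topspace Q"
      using \<psi>_mem D by blast
    fix \<sigma> w assume \<sigma>: "inj \<sigma>" "range \<sigma> \<subseteq> \<psi> ` D" "limitin Q \<sigma> w sequentially"
    have w: "w \<in> topspace Q"
      using \<sigma>(3) by (auto simp: limitin_def)
    show "w \<in> \<psi> ` D"
    proof (rule ccontr)
      assume nw: "w \<notin> \<psi> ` D"
      have "\<exists>z\<in>D. \<psi> z = \<sigma> n" for n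
        using \<sigma>(2) by (metis imageE rangeI subsetD)
      then obtain y where y: "\<And>n. y n \<in> D" "\<And>n. \<psi> (y n) = \<sigma> n"
        by metis
      have yZ: "y n \<in> Z" for n
        using y D by auto
      have rY: "range y \<subseteq> topspace Y"
        using yZ tagged_piece_facts(2) by auto
      show False
      proof (rule no_discrete_sequence)
        show "inj y"
          using \<sigma>(1) y(2) by (metis injD injI)
        show "finite (w ` {..<q})" "w ` {..<q} \<subseteq> topspace X"
          using w by auto
        show "controls (y n) (supp p q (y n)) p" for n
          using tagged_piece_facts(6) yZ by blast
        show "\<forall>\<^sub>F n in sequentially. supp p q (y n) \<subseteq> G" if G: "openin X G" "w ` {..<q} \<subseteq> G" for G
        proof -
          have "openin Q (PiE {..<q} (\<lambda>i. G))"
            using G by (simp add: openin_PiE_gen)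
          moreover have "w \<in> PiE {..<q} (\<lambda>i. G)"
            using w G by (auto simp: PiE_iff)
          ultimately have "\<forall>\<^sub>F n in sequentially. \<sigma> n \<in> PiE {..<q} (\<lambda>i. G)"
            using \<sigma>(3) by (auto simp: limitin_def)
          then show ?thesis
          proof (rule eventually_mono)
            fix n assume n: "\<sigma> n \<in> PiE {..<q} (\<lambda>i. G)"
            have "supp p q (y n) = \<sigma> n ` {..<q}"
              using \<psi>_image[OF yZ] y(2) by simp
            then show "supp p q (y n) \<subseteq> G"
              using n by auto
          qed
        qed
        show "closedin Y S" if S: "S \<subseteq> range y" for S
          unfolding closedin_contains_derived_set
        proof
          show "S \<subseteq> topspace Y"
            using S rY by auto
          have "u \<notin> Y derived_set_of S" for u
          proof
            assume u: "u \<in> Y derived_set_of S"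
            have "S \<subseteq> D"
              using S y by auto
            then have "Y derived_set_of S \<subseteq> D"
              using D(1) derived_set_of_mono[of S D Y] by (auto simp: closedin_contains_derived_set)
            then have uD: "u \<in> D"
              using u by auto
            then have uZ: "u \<in> Z" "u \<in> topspace Y"
              using D tagged_piece_facts(2) by auto
            have "\<psi> u \<noteq> w"
              using nw uD by auto
            moreover have "\<psi> u \<in> topspace Q"
              using \<psi>_mem uZ by blast
            ultimately obtain G H where GH: "openin Q G" "openin Q H" "w \<in> G" "\<psi> u \<in> H" "disjnt G H"
              using metrizable_imp_Hausdorff_space[OF Q] w unfolding Hausdorff_space_def by metis
            obtain N where N: "\<And>n. n \<ge> N \<Longrightarrow> \<sigma> n \<in> G"
              using \<sigma>(3) GH unfolding limitin_def eventually_sequentially by blast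
            have "openin (subtopology Y Z) {z \<in> topspace (subtopology Y Z). \<psi> z \<in> H}"
              using continuous_map_\<psi> GH(2) by (rule openin_continuous_map_preimage)
            then obtain B where B: "openin Y B" "{z \<in> topspace (subtopology Y Z). \<psi> z \<in> H} = B \<inter> Z"
              unfolding openin_subtopology by blast
            \<comment> \<open>Discarding the finitely many early terms forces the nearby point of
              \<open>S\<close> to have an index of at least \<open>N\<close>; \<open>u\<close>
              itself is retained, since it may be one of them.\<close>
            define B' where "B' = B - (y ` {..<N} - {u})"
            have "openin Y B'"
              unfolding B'_def using B(1) rY by (intro openin_diff closedin_finite_Y) auto
            moreover have "u \<in> B'"
            proof -
              have "u \<in> B"
                using B(2) uZ GH(4) by auto
              then show ?thesis
                by (simp add: B'_def)
            qed
            ultimately obtain z where z: "z \<noteq> u" "z \<in> S" "z \<in> B'"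
              using u unfolding in_derived_set_of by blast
            then obtain n where n: "z = y n"
              using S by auto
            then have "n \<ge> N"
              using z by (auto simp: B'_def not_less[symmetric])
            then have "\<sigma> n \<in> G"
              by (rule N)
            moreover have "z \<in> B \<inter> Z"
              using z n yZ by (auto simp: B'_def)
            then have "\<psi> z \<in> H"
              using B(2) by blast
            then have "\<sigma> n \<in> H"
              using n y(2) by simp
            ultimately show False
              using GH(5) by (auto simp: disjnt_iff)
          qed
          then show "Y derived_set_of S \<subseteq> S"
            by auto
        qed
      qed
    qed
  qed
qed

lemma tagged_piece_finite_to_one:
  assumes "metrizable_space X"
  obtains h where "continuous_map (subtopology Y Z) (product_topology (\<lambda>i. X) {..<q}) h"
    "closed_map (subtopology Y Z) (product_topology (\<lambda>i. X) {..<q}) h"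
    "\<forall>w\<in>topspace (product_topology (\<lambda>i. X) {..<q}). finite {y \<in> Z. h y = w}"
  using continuous_map_\<psi> closed_map_\<psi>[OF assms] finite_fibres_\<psi> by (intro that ballI)

end

end

section \<open>Copies of finite powers and the conclusion\<close>

text \<open>By induction from a bijection of \<open>S \<times> S\<close> with \<open>S\<close>: a
  tuple of length \<open>q + 1\<close> splits into its restriction and its last entry.\<close>

lemma infinite_finite_power_injection:
  assumes S: "infinite S"
  obtains h where "inj_on h (PiE {..<q::nat} (\<lambda>i. S))" "h ` PiE {..<q} (\<lambda>i. S) \<subseteq> S"
proof -
  obtain b where b: "bij_betw b (S \<times> S) S"
    using card_of_Times_same_infinite[OF S] card_of_ordIso by blast
  have "\<exists>h. inj_on h (PiE {..<q} (\<lambda>i. S)) \<and> h ` PiE {..<q} (\<lambda>i. S) \<subseteq> S"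
  proof (induction q)
    case 0
    obtain s where "s \<in> S"
      using S by (metis ex_in_conv finite.emptyI)
    then show ?case
      by (intro exI[of _ "\<lambda>_. s"]) auto
  next
    case (Suc q)
    then obtain h where h: "inj_on h (PiE {..<q} (\<lambda>i. S))" "h ` PiE {..<q} (\<lambda>i. S) \<subseteq> S"
      by auto
    define r where "r f = restrict f {..<q}" for f :: "nat \<Rightarrow> 'a"
    have r: "r f \<in> PiE {..<q} (\<lambda>i. S)" "f q \<in> S" if "f \<in> PiE {..<Suc q} (\<lambda>i. S)" for f
      using that PiE_mem[OF that, of q] by (simp_all add: r_def PiE_iff)
    define k where "k f = b (h (r f), f q)" for f
    have mem: "(h (r f), f q) \<in> S \<times> S" if "f \<in> PiE {..<Suc q} (\<lambda>i. S)" for f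
      using r[OF that] h(2) by blast
    have "inj_on k (PiE {..<Suc q} (\<lambda>i. S))"
    proof (rule inj_onI)
      fix f g assume f: "f \<in> PiE {..<Suc q} (\<lambda>i. S)" and g: "g \<in> PiE {..<Suc q} (\<lambda>i. S)"
        and eq: "k f = k g"
      have "(h (r f), f q) = (h (r g), g q)"
        using b mem[OF f] mem[OF g] eq by (auto simp: k_def bij_betw_def inj_on_def)
      then have eqs: "r f = r g" "f q = g q"
        using h(1) r(1)[OF f] r(1)[OF g] by (auto simp: inj_on_def)
      have "f i = g i" if "i < Suc q" for i
      proof (cases "i = q")
        case False
        then have "i < q"
          using that by simp
        then show ?thesis
          using fun_cong[OF eqs(1), of i] by (simp add: r_def)
      qed (simp add: eqs)
      then show "f = g"
        using f g by (auto intro: PiE_ext)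
    qed
    moreover have "k ` PiE {..<Suc q} (\<lambda>i. S) \<subseteq> S"
    proof
      fix s assume "s \<in> k ` PiE {..<Suc q} (\<lambda>i. S)"
      then obtain f where f: "f \<in> PiE {..<Suc q} (\<lambda>i. S)" "s = k f"
        by blast
      then show "s \<in> S"
        using bij_betwE[OF b] mem[OF f(1)] by (auto simp: k_def)
    qed
    ultimately show ?case
      by blast
  qed
  then show ?thesis
    using that by blast
qed

text \<open>Transports the topology along the injection, so that a power of \<open>X\<close> gets a
  copy on the point type of \<open>X\<close>.\<close>

lemma homeomorphic_copy:
  fixes h :: "'a \<Rightarrow> 'b"
  assumes h: "inj_on h (topspace Q)"
  obtains W :: "'b topology" where "Q homeomorphic_space W"
proof -
  define g where "g = inv_into (topspace Q) h"
  define W where "W = pullback_topology (h ` topspace Q) g Q"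
  have gh: "g (h x) = x" if "x \<in> topspace Q" for x
    using h that by (simp add: g_def)
  have top: "topspace W = h ` topspace Q"
    using gh by (auto simp: W_def topspace_pullback_topology)
  have "continuous_map W Q (id \<circ> g)"
    unfolding W_def by (rule continuous_map_pullback) auto
  moreover have "continuous_map Q W h"
    unfolding W_def
  proof (rule continuous_map_pullback')
    show "continuous_map Q Q (g \<circ> h)"
      by (rule continuous_map_eq[OF continuous_map_id]) (simp add: gh)
  qed auto
  ultimately have "homeomorphic_maps Q W h g"
    using gh by (auto simp: homeomorphic_maps_def top)
  then have "Q homeomorphic_space W"
    unfolding homeomorphic_space_def by blast
  then show ?thesis
    by (rule that)
qed

lemma infinite_space_power_copy:
  fixes X :: "'a topology"
  assumes "infinite (topspace X)"
  obtains W :: "'a topology" where "product_topology (\<lambda>i. X) {..<q::nat} homeomorphic_space W"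
proof -
  obtain h :: "(nat \<Rightarrow> 'a) \<Rightarrow> 'a" where "inj_on h (PiE {..<q} (\<lambda>i. topspace X))"
    using infinite_finite_power_injection[OF assms, of q] by blast
  then have "inj_on h (topspace (product_topology (\<lambda>i. X) {..<q}))"
    by simp
  then show ?thesis
    by (rule homeomorphic_copy) (rule that)
qed

lemma T4_space_closed_subtopology:
  assumes "T4_space Z" "closedin Z F"
  shows "T4_space (subtopology Z F)"
  using assms by (auto simp: T4_space_def Hausdorff_space_subtopology normal_space_closed_subtopology)

lemma metrizable_imp_T4_space: "metrizable_space X \<Longrightarrow> T4_space X"
  by (simp add: T4_space_def metrizable_imp_normal_space metrizable_imp_Hausdorff_space)

lemma homeomorphic_singletons:
  assumes "x \<in> topspace X" "y \<in> topspace Y"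
  shows "subtopology X {x} homeomorphic_space subtopology Y {y}"
  unfolding homeomorphic_space_def homeomorphic_maps_def
  by (rule exI[of _ "\<lambda>_. y"], rule exI[of _ "\<lambda>_. x"]) (use assms in \<open>auto simp: continuous_map_in_subtopology\<close>)

text \<open>The whole finite space \<open>X\<close> controls every point with some natural bound,
  and only finitely many points for each bound.\<close>

lemma (in uniform_surjection) countable_topspace_Y:
  assumes "finite (topspace X)"
  shows "countable (topspace Y)"
proof -
  have "topspace Y \<subseteq> (\<Union>n::nat. {y \<in> topspace Y. controls y (topspace X) (real n)})"
  proof
    fix y assume y: "y \<in> topspace Y"
    then obtain K and n :: nat where K: "finite K" "K \<subseteq> topspace X" "controls y K (real n)"
      by (rule controls_exists)
    then have "controls y (topspace X) (real n)"
      using controls_mono by blast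
    then show "y \<in> (\<Union>n::nat. {y \<in> topspace Y. controls y (topspace X) (real n)})"
      using y by blast
  qed
  moreover have "finite {y \<in> topspace Y. controls y (topspace X) (real n)}" for n :: nat
    using assms by (intro finite_controlled) auto
  then have "countable (\<Union>n::nat. {y \<in> topspace Y. controls y (topspace X) (real n)})"
    by (intro countable_UN) (auto intro: countable_finite)
  ultimately show ?thesis
    by (rule countable_subset)
qed

lemma (in uniform_surjection) fsigma_region:
  assumes "perfectly_normal_space Y"
  obtains C where "\<And>n::nat. closedin Y (C n)" "(\<Union>n. C n) = region p q"
proof -
  have "gdelta_in Y (level (2 * p) (q - 1))"
    using assms closedin_level by (auto simp: perfectly_normal_space_def)
  then have "fsigma_in Y (topspace Y - level (2 * p) (q - 1))"
    by (simp add: gdelta_in_fsigma_in)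
  then obtain C where C: "\<And>n::nat. closedin Y (C n)" "(\<Union>n. C n) = topspace Y - level (2 * p) (q - 1)"
    unfolding fsigma_in_ascending by blast
  show ?thesis
  proof
    show "closedin Y (level p q \<inter> C n)" for n
      using closedin_level C by blast
    show "(\<Union>n. level p q \<inter> C n) = region p q"
      using C(2) by (auto simp: region_def level_def)
  qed
qed

theorem theorem1p4:
  fixes X Y :: "'u topology"
    and DX DY :: "('u \<Rightarrow> real) set"
    and T :: "('u \<Rightarrow> real) \<Rightarrow> ('u \<Rightarrow> real)"
    and P :: "'u topology \<Rightarrow> bool"
  assumes "metrizable_space X"
    and "perfectly_normal_space Y"
    and "DX = C_fun X \<or> DX = Cstar_fun X"
    and "DY = C_fun Y \<or> DY = Cstar_fun Y"
    and "T ` DX = DY"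
    and "uniformly_continuous_Dp X DX Y DY T"
    and "inversely_bounded X Y T"
    and "property_of_normal_spaces P"
    and "closed_hereditary P"
    and "finitely_productive P"
    and "closed_under_countable_closed_unions P"
    and "pulled_back_by_closed_finite_fiber_maps P"
    and "P X"
  shows "P Y"
proof -
  have T4Y: "T4_space Y"
    using assms(2) by (simp add: perfectly_normal_space_def)
  interpret uniform_surjection X Y DX DY T
    by unfold_locales (use assms T4Y metrizable_imp_T4_space in auto)
  have union: "P Y" if "countable \<K>" "\<And>F. F \<in> \<K> \<Longrightarrow> closedin Y F \<and> P (subtopology Y F)"
    "\<Union>\<K> = topspace Y" for \<K>
    using assms(11) T4Y that unfolding closed_under_countable_closed_unions_def by blast
  show ?thesis
  proof (cases "finite (topspace X)")
    \<comment> \<open>Here \<open>Y\<close> is a countable union of closed singletons, each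
      homeomorphic to a closed singleton of \<open>X\<close>.\<close>
    case True
    show ?thesis
    proof (rule union)
      show "countable ((\<lambda>y. {y}) ` topspace Y)"
        using countable_topspace_Y[OF True] by simp
      show "\<Union>((\<lambda>y. {y}) ` topspace Y) = topspace Y"
        by auto
      fix F assume "F \<in> (\<lambda>y. {y}) ` topspace Y"
      then obtain y where y: "y \<in> topspace Y" "F = {y}"
        by auto
      obtain K and n :: nat where K: "finite K" "K \<subseteq> topspace X" "controls y K (real n)"
        by (rule controls_exists[OF y(1)])
      \<comment> \<open>A point of \<open>Y\<close> forces \<open>X\<close> to be nonempty, as the
        empty set controls nothing.\<close>
      then have "K \<noteq> {}"
        using not_controls_empty[OF y(1)] by auto
      then obtain x where x: "x \<in> topspace X"
        using K by auto
      then have "P (subtopology X {x})"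
        using assms(9,13) closedin_finite_X[of "{x}"] by (auto simp: closed_hereditary_def)
      then have "P (subtopology Y F)"
        using homeomorphic_singletons[OF x y(1)] assms(8) y(2)
        unfolding property_of_normal_spaces_def by blast
      then show "closedin Y F \<and> P (subtopology Y F)"
        using closedin_finite_Y[of F] y by auto
    qed
  next
    case infinite: False
    obtain A :: "nat \<Rightarrow> 'u set" and t :: "nat \<Rightarrow> 'u \<Rightarrow> 'u" where A: "\<forall>i. closedin X (A i)"
      and t: "\<forall>i. \<forall>x\<in>A i. \<exists>G. openin X G \<and> x \<in> G \<and> (\<forall>z\<in>G \<inter> A i. t i z = t i x)"
      and separate: "\<forall>K. finite K \<longrightarrow> K \<subseteq> topspace X \<longrightarrow> (\<exists>i. K \<subseteq> A i \<and> inj_on (t i) K)"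
      by (rule metrizable_tagged_closed_cover[OF assms(1)])
    have "\<exists>C. (\<forall>n::nat. closedin Y (C n)) \<and> (\<Union>n. C n) = region p q" for p q
      using fsigma_region[OF assms(2), of p q] by metis
    then obtain C where C: "\<And>p q n. closedin Y (C p q (n::nat))" "\<And>p q. (\<Union>n. C p q n) = region p q"
      by metis
    \<comment> \<open>The indices are the bound, the size, the closed part of the region and the
      cover member. The union runs over \<open>q > 0\<close> because
      \<open>finitely_productive\<close> speaks of nonempty index sets.\<close>
    define Z where "Z = (\<lambda>(p::nat, q, n, i). tagged_piece (A i) (t i) p q (C p q n))"
    show ?thesis
    proof (rule union)
      show "countable (Z ` (UNIV \<times> {0<..} \<times> UNIV \<times> UNIV))"
        by simp
      show "\<Union>(Z ` (UNIV \<times> {0<..} \<times> UNIV \<times> UNIV)) = topspace Y"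
      proof
        show "\<Union>(Z ` (UNIV \<times> {0<..} \<times> UNIV \<times> UNIV)) \<subseteq> topspace Y"
          using C(1)[THEN closedin_subset] by (force simp: Z_def tagged_piece_def)
        show "topspace Y \<subseteq> \<Union>(Z ` (UNIV \<times> {0<..} \<times> UNIV \<times> UNIV))"
        proof
          fix y assume "y \<in> topspace Y"
          then obtain p :: nat and q where pq: "q > 0" "y \<in> region p q"
            by (rule region_cover)
          have "supports p q y (supp p q y)"
            using supports_supp[OF pq(2)] by simp
          then obtain i where i: "supp p q y \<subseteq> A i" "inj_on (t i) (supp p q y)"
            using separate by (auto simp: supports_def)
          obtain n where n: "y \<in> C p q n"
            using pq(2) C(2)[of p q] by blast
          have "y \<in> Z (p, q, n, i)"
            using i n by (simp add: Z_def tagged_piece_def)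
          then show "y \<in> \<Union>(Z ` (UNIV \<times> {0<..} \<times> UNIV \<times> UNIV))"
            using pq(1) by blast
        qed
      qed
      fix F assume "F \<in> Z ` (UNIV \<times> {0<..} \<times> UNIV \<times> UNIV)"
      then obtain p q n i where F: "F = tagged_piece (A i) (t i) (real p) q (C p q n)" and q: "q > 0"
        by (auto simp: Z_def)
      have sub: "C p q n \<subseteq> region p q"
        using C(2) by blast
      have p: "0 \<le> real p"
        by simp
      have A': "closedin X (A i)"
        using A by blast
      have t': "\<exists>G. openin X G \<and> x \<in> G \<and> (\<forall>z\<in>G \<inter> A i. t i z = t i x)" if "x \<in> A i" for x
        using t that by blast
      have cF: "closedin Y F"
        unfolding F by (rule closedin_tagged_piece[OF A' t' p C(1) sub])
      let ?Q = "product_topology (\<lambda>i. X) {..<q}"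
      obtain h where h: "continuous_map (subtopology Y F) ?Q h" "closed_map (subtopology Y F) ?Q h"
          "\<forall>w\<in>topspace ?Q. finite {y \<in> F. h y = w}"
        unfolding F by (rule tagged_piece_finite_to_one[OF A' t' p C(1) sub assms(1)])
      \<comment> \<open>The power must be copied into the universe before \<open>P\<close> can be
        applied to it; the map into the power is then composed with the homeomorphism.\<close>
      obtain W :: "'u topology" where W: "?Q homeomorphic_space W"
        by (rule infinite_space_power_copy[OF infinite])
      then obtain k where k: "homeomorphic_map ?Q W k"
        by (auto simp: homeomorphic_space)
      have "metrizable_space ?Q"
        using assms(1) by (simp add: metrizable_space_product_topology)
      then have mW: "metrizable_space W"
        using W homeomorphic_metrizable_space by blast
      have "P W"
        using assms(10,13) q W metrizable_imp_T4_space[OF mW]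
        unfolding finitely_productive_def
        by (metis homeomorphic_space_sym finite_lessThan lessThan_empty_iff not_gr_zero)
      moreover have "continuous_map (subtopology Y F) W (k \<circ> h)"
        using h(1) homeomorphic_imp_continuous_map[OF k] by (rule continuous_map_compose)
      moreover have "closed_map (subtopology Y F) W (k \<circ> h)"
        using h(2) homeomorphic_imp_closed_map[OF k] by (rule closed_map_compose)
      moreover have "finite {z \<in> topspace (subtopology Y F). (k \<circ> h) z = w}"
        if w: "w \<in> topspace W" for w
      proof -
        have "w \<in> k ` topspace ?Q"
          using w homeomorphic_imp_surjective_map[OF k] by simp
        then obtain v where v: "v \<in> topspace ?Q" "k v = w"
          by (elim imageE) simp
        have "{z \<in> topspace (subtopology Y F). (k \<circ> h) z = w} \<subseteq> {y \<in> F. h y = v}"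
        proof
          fix z assume z: "z \<in> {z \<in> topspace (subtopology Y F). (k \<circ> h) z = w}"
          then have "h z \<in> topspace ?Q" "k (h z) = k v"
            using h(1) v by (auto simp: continuous_map_def)
          then have "h z = v"
            using homeomorphic_imp_injective_map[OF k] v(1) by (auto simp: inj_on_def)
          then show "z \<in> {y \<in> F. h y = v}"
            using z by auto
        qed
        then show ?thesis
          using h(3) v(1) finite_subset by blast
      qed
      ultimately have "P (subtopology Y F)"
        using assms(12) mW T4_space_closed_subtopology[OF T4Y cF]
        unfolding pulled_back_by_closed_finite_fiber_maps_def by blast
      then show "closedin Y F \<and> P (subtopology Y F)"
        using cF by blast
    qed
  qed
qed

end
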